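(* Let $(X,d)$ be a metric space that is a Polish space and let $m\ge1$. Let $\mu\in\mathcal{W}(X,\mathbb{R}^m)$, let $u\in\mathcal{L}(X,\mathbb{R}^m)$ be a $1$-Lipschitz map and let $\pi\in\Gamma(\mu)$. The following conditions are equivalent: (i) $\displaystyle\int_X \langle u,d\mu\rangle=\int_{X\times X}d(x,y)\,d\|\pi\|(x,y)=\|\mu\|_{\mathcal{W}(X,\mathbb{R}^m)}$; (ii) $\displaystyle\int_A \langle u(x)-u(y),d\pi(x,y) \rangle=\int_A d(x,y)\,d\|\pi\|(x,y)$ for any Borel set $A\subset X\times X$; (iii) $\displaystyle\int_X \langle u,d\mu\rangle=\int_{X\times X} d(x,y)\,d\|\pi\|(x,y)$; (iv) $u$ is an optimal potential for $\mu$ and $\pi$ is an optimal transport for $\mu$. Moreover, if the equivalent conditions (i), (ii), (iii), (iv) hold, then $\|u(x)-u(y)\|=d(x,y)$ for $\|\pi\|$-almost every $(x,y)\in X\times X$.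
   Context: $\mathbb{R}^m$ carries the Euclidean norm $\|\cdot\|$ and the standard scalar product $\langle\cdot,\cdot\rangle$. For an $\mathbb{R}^m$-valued Borel measure $\mu$, $\|\mu\|$ denotes its total variation measure, and $\int\langle u,d\mu\rangle=\sum_{i=1}^m\int u_i\,d\mu_i$. For an $\mathbb{R}^m$-valued Borel measure $\pi$ on $X\times X$, its marginals are $\mathrm{P}_1\pi(A)=\pi(A\times X)$ and $\mathrm{P}_2\pi(A)=\pi(X\times A)$ for Borel $A\subset X$. $\Gamma(\mu)$ is the set of all $\mathbb{R}^m$-valued Borel measures $\pi$ on $X\times X$ with $\mathrm{P}_1\pi-\mathrm{P}_2\pi=\mu$. The Wasserstein space $\mathcal{W}(X,\mathbb{R}^m)$ is the space of all $\mathbb{R}^m$-valued Borel measures $\mu$ on $X$ with $\mu(X)=0$ and $\int_X d(x,x_0)\,d\|\mu\|(x)<\infty$ for some $x_0\in X$, with the norm $$\|\mu\|_{\mathcal{W}(X,\mathbb{R}^m)}=\inf\Big\{\int_{X\times X}d(x,y)\,d\|\pi\|(x,y)\mid \pi\in\Gamma(\mu)\Big\}.$$ For a fixed $x_0\in X$, $\mathcal{L}(X,\mathbb{R}^m)$ is the space of Lipschitz maps $u\colon X\to\mathbb{R}^m$ with $u(x_0)=0$. A $1$-Lipschitz map $u\colon X\to\mathbb{R}^m$ is an optimal potential of $\mu$ if $\int_X\langle u,d\mu\rangle=\sup\{\int_X\langle v,d\mu\rangle\mid v\colon X\to\mathbb{R}^m\text{ is }1\text{-Lipschitz}\}$. A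 measure $\pi\in\Gamma(\mu)$ is an optimal transport for $\mu$ if $\|\mu\|_{\mathcal{W}(X,\mathbb{R}^m)}=\int_{X\times X}d(x,y)\,d\|\pi\|(x,y)$. *)

theory Defs
  imports "HOL-Analysis.Analysis"
begin

section \<open>Vector-valued Borel measures\<close>

text \<open>
  A vector-valued Borel measure is a countably additive set function on the Borel sets; its values
  on other sets are irrelevant, and no definition below looks at them. Countable additivity
  forces the value on the empty set to be zero, so it includes finite additivity.
\<close>

definition vector_measure :: "('a::topological_space set \<Rightarrow> 'b::real_normed_vector) \<Rightarrow> bool" where
  "vector_measure \<mu> \<longleftrightarrow>
     (\<forall>A::nat \<Rightarrow> 'a set. range A \<subseteq> sets borel \<longrightarrow> disjoint_family A \<longrightarrow>
        (\<lambda>n. \<mu> (A n)) sums \<mu> (\<Union>n. A n))"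

definition borel_partitions :: "'a::topological_space set \<Rightarrow> (nat \<Rightarrow> 'a set) set" where
  "borel_partitions A = {P. range P \<subseteq> sets borel \<and> disjoint_family P \<and> (\<Union>n. P n) = A}"

definition total_variation ::
    "('a::topological_space set \<Rightarrow> 'b::real_normed_vector) \<Rightarrow> 'a measure" where
  "total_variation \<mu> = measure_of UNIV (sets borel)
     (\<lambda>A. SUP P\<in>borel_partitions A. \<Sum>n. ennreal (norm (\<mu> (P n))))"

text \<open>
  The positive part of a signed measure in its Jordan decomposition; the negative part of
  \<open>\<nu>\<close> is the positive part of \<open>- \<nu>\<close>.
\<close>

definition positive_part :: "('a::topological_space set \<Rightarrow> real) \<Rightarrow> 'a measure" where
  "positive_part \<nu> = measure_of UNIV (sets borel)
     (\<lambda>A. SUP B\<in>{B \<in> sets borel. B \<subseteq> A}. ennreal (\<nu> B))"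

text \<open>
  As \<^const>\<open>measure_of\<close> yields the zero measure on set functions that are not measures,
  the lemmas \<open>emeasure_total_variation\<close> and \<open>emeasure_positive_part\<close> below record that the
  two definitions take the intended values.
\<close>

lemma vector_measure_sums:
  assumes "vector_measure \<mu>" "range A \<subseteq> sets borel" "disjoint_family (A :: nat \<Rightarrow> _)"
  shows "(\<lambda>n. \<mu> (A n)) sums \<mu> (\<Union>n. A n)"
  using assms by (auto simp: vector_measure_def)

lemma vector_measure_empty:
  assumes "vector_measure (\<mu> :: 'a::topological_space set \<Rightarrow> 'b::real_normed_vector)"
  shows "\<mu> {} = 0"
proof -
  have "(\<lambda>n::nat. \<mu> {}) sums \<mu> (\<Union>n::nat. {})"
    by (rule vector_measure_sums[OF assms]) (auto simp: disjoint_family_on_def)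
  then have "summable (\<lambda>n::nat. \<mu> {})"
    by (rule sums_summable)
  then have "(\<lambda>n::nat. \<mu> {}) \<longlonglongrightarrow> 0"
    by (rule summable_LIMSEQ_zero)
  then show ?thesis
    by (simp add: LIMSEQ_const_iff)
qed

lemma vector_measure_Un:
  assumes "vector_measure (\<mu> :: 'a::topological_space set \<Rightarrow> 'b::real_normed_vector)"
    and "A \<in> sets borel" "B \<in> sets borel" "A \<inter> B = {}"
  shows "\<mu> (A \<union> B) = \<mu> A + \<mu> B"
proof -
  have "(\<lambda>n. \<mu> (binaryset A B n)) sums \<mu> (\<Union>n. binaryset A B n)"
    by (rule vector_measure_sums[OF assms(1)])
       (use assms in \<open>auto simp: range_binaryset_eq disjoint_family_on_def binaryset_def\<close>)
  moreover have "(\<lambda>n. \<mu> (binaryset A B n)) sums (\<mu> A + \<mu> B)"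
    by (rule binaryset_sums) (rule vector_measure_empty[OF assms(1)])
  ultimately show ?thesis
    by (metis sums_unique2 UN_binaryset_eq)
qed

text \<open>A monotone, superadditive and countably subadditive set function is a measure.\<close>

lemma measure_space_borelI:
  fixes f :: "'a::topological_space set \<Rightarrow> ennreal"
  assumes empty: "f {} = 0"
    and mono: "\<And>A B. A \<in> sets borel \<Longrightarrow> B \<in> sets borel \<Longrightarrow> A \<subseteq> B \<Longrightarrow> f A \<le> f B"
    and super: "\<And>A B. A \<in> sets borel \<Longrightarrow> B \<in> sets borel \<Longrightarrow> A \<inter> B = {} \<Longrightarrow> f A + f B \<le> f (A \<union> B)"
    and sub: "\<And>A. range A \<subseteq> sets borel \<Longrightarrow> disjoint_family (A :: nat \<Rightarrow> _) \<Longrightarrow>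
                f (\<Union>n. A n) \<le> (\<Sum>n. f (A n))"
    and A: "A \<in> sets borel"
  shows "emeasure (measure_of UNIV (sets borel) f) A = f A"
proof (rule emeasure_measure_of_sigma)
  show "sigma_algebra (UNIV :: 'a set) (sets borel)"
    using sets.sigma_algebra_axioms[of "borel :: 'a measure"] by simp
  show "positive (sets borel) f"
    using empty by (simp add: positive_def)
  show "countably_additive (sets borel) f"
  proof (rule countably_additiveI)
    fix A :: "nat \<Rightarrow> 'a set"
    assume A: "range A \<subseteq> sets borel" "disjoint_family A" "(\<Union>n. A n) \<in> sets borel"
    have fin: "(\<Sum>n<N. f (A n)) \<le> f (\<Union>n<N. A n)" for N
    proof (induction N)
      case (Suc N)
      have "(\<Sum>n<Suc N. f (A n)) \<le> f (\<Union>n<N. A n) + f (A N)"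
        using Suc by (simp add: add_right_mono)
      also have "\<dots> \<le> f ((\<Union>n<N. A n) \<union> A N)"
      proof (rule super)
        show "(\<Union>n<N. A n) \<in> sets borel" "A N \<in> sets borel"
          using A(1) by auto
        show "(\<Union>n<N. A n) \<inter> A N = {}"
        proof -
          have "A n \<inter> A N = {}" if "n < N" for n
            using A(2) that by (simp add: disjoint_family_on_def)
          then show ?thesis by blast
        qed
      qed
      also have "(\<Union>n<N. A n) \<union> A N = (\<Union>n<Suc N. A n)"
        by (auto simp: less_Suc_eq)
      finally show ?case .
    qed (simp add: empty)
    have "(\<Sum>n. f (A n)) \<le> f (\<Union>n. A n)"
    proof (rule suminf_le_const)
      fix N
      have "f (\<Union>n<N. A n) \<le> f (\<Union>n. A n)"
        using A by (intro mono) auto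
      then show "(\<Sum>n<N. f (A n)) \<le> f (\<Union>n. A n)"
        using fin[of N] by simp
    qed simp
    then show "(\<Sum>n. f (A n)) = f (\<Union>n. A n)"
      using sub[OF A(1,2)] by (rule antisym)
  qed
  show "A \<in> sets borel" by (rule A)
qed

lemma SUP_add_SUP_le:
  fixes f :: "'a \<Rightarrow> ennreal" and g :: "'b \<Rightarrow> ennreal"
  assumes "I \<noteq> {}" "J \<noteq> {}" and "\<And>i j. i \<in> I \<Longrightarrow> j \<in> J \<Longrightarrow> f i + g j \<le> c"
  shows "(SUP i\<in>I. f i) + (SUP j\<in>J. g j) \<le> c"
proof -
  have "f i + (SUP j\<in>J. g j) \<le> c" if "i \<in> I" for i
    unfolding ennreal_SUP_add_right[OF assms(2)] using assms(3) that by (auto intro: SUP_least)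
  then show ?thesis
    unfolding ennreal_SUP_add_left[OF assms(1), symmetric] by (auto intro: SUP_least)
qed

lemma emeasure_positive_part:
  assumes \<nu>: "vector_measure \<nu>" and A: "A \<in> sets borel"
  shows "emeasure (positive_part \<nu>) A = (SUP B\<in>{B \<in> sets borel. B \<subseteq> A}. ennreal (\<nu> B))"
proof -
  let ?f = "\<lambda>A. SUP B\<in>{B \<in> sets borel. B \<subseteq> A}. ennreal (\<nu> B)"
  have "{B \<in> sets borel. B \<subseteq> {}} = {{} :: 'a set}" by auto
  then have empty: "?f {} = 0"
    by (simp add: vector_measure_empty[OF \<nu>])
  have mono: "?f A \<le> ?f B" if "A \<subseteq> B" for A B
    by (rule SUP_subset_mono) (use that in auto)
  have super: "?f A + ?f B \<le> ?f (A \<union> B)" if AB: "A \<inter> B = {}" for A B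
  proof -
    have *: "ennreal (\<nu> C) + ennreal (\<nu> D) \<le> ?f (A \<union> B)"
      if C: "C \<in> sets borel" "C \<subseteq> A" and D: "D \<in> sets borel" "D \<subseteq> B" for C D
    proof -
      have up: "E \<in> sets borel \<Longrightarrow> E \<subseteq> A \<union> B \<Longrightarrow> ennreal (\<nu> E) \<le> ?f (A \<union> B)" for E
        by (rule SUP_upper) auto
      have "\<nu> (C \<union> D) = \<nu> C + \<nu> D"
        by (rule vector_measure_Un[OF \<nu>]) (use C D AB in auto)
      then have "0 \<le> \<nu> C \<Longrightarrow> 0 \<le> \<nu> D \<Longrightarrow> ennreal (\<nu> C) + ennreal (\<nu> D) = ennreal (\<nu> (C \<union> D))"
        by simp
      moreover have "ennreal (\<nu> (C \<union> D)) \<le> ?f (A \<union> B)" "ennreal (\<nu> C) \<le> ?f (A \<union> B)"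
          "ennreal (\<nu> D) \<le> ?f (A \<union> B)"
        using C D by (auto intro!: up)
      ultimately show ?thesis
        by (cases "0 \<le> \<nu> C"; cases "0 \<le> \<nu> D") (simp_all add: ennreal_neg)
    qed
    show ?thesis
    proof (rule SUP_add_SUP_le)
      show "{C \<in> sets borel. C \<subseteq> A} \<noteq> {}" "{D \<in> sets borel. D \<subseteq> B} \<noteq> {}" by blast+
    qed (use * in auto)
  qed
  have sub: "?f (\<Union>n. A n) \<le> (\<Sum>n. ?f (A n))"
    if A: "range A \<subseteq> sets borel" "disjoint_family A" for A :: "nat \<Rightarrow> _"
  proof (rule SUP_least)
    fix B assume "B \<in> {B \<in> sets borel. B \<subseteq> (\<Union>n. A n)}"
    then have B: "B \<in> sets borel" "B = (\<Union>n. B \<inter> A n)" by auto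
    have "(\<lambda>n. \<nu> (B \<inter> A n)) sums \<nu> (\<Union>n. B \<inter> A n)"
      by (rule vector_measure_sums[OF \<nu>])
         (use A B in \<open>auto simp: disjoint_family_on_def\<close>)
    then have s: "(\<lambda>n. \<nu> (B \<inter> A n)) sums \<nu> B"
      using B(2) by simp
    have "ennreal (\<nu> B) \<le> (\<Sum>n. ennreal (\<nu> (B \<inter> A n)))"
    proof (rule LIMSEQ_le_const2)
      show "(\<lambda>N. ennreal (\<Sum>n<N. \<nu> (B \<inter> A n))) \<longlonglongrightarrow> ennreal (\<nu> B)"
        using s by (intro tendsto_ennrealI) (simp add: sums_def)
      have "ennreal (\<Sum>n<N. \<nu> (B \<inter> A n)) \<le> (\<Sum>n. ennreal (\<nu> (B \<inter> A n)))" for N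
      proof -
        have "ennreal (\<Sum>n<N. \<nu> (B \<inter> A n)) \<le> ennreal (\<Sum>n<N. max 0 (\<nu> (B \<inter> A n)))"
          by (intro ennreal_leI sum_mono) auto
        also have "\<dots> = (\<Sum>n<N. ennreal (max 0 (\<nu> (B \<inter> A n))))"
          by (rule sum_ennreal[symmetric]) auto
        also have "\<dots> = (\<Sum>n<N. ennreal (\<nu> (B \<inter> A n)))"
          by (simp add: ennreal_max_0)
        also have "\<dots> \<le> (\<Sum>n. ennreal (\<nu> (B \<inter> A n)))"
          by (rule sum_le_suminf) auto
        finally show ?thesis .
      qed
      then show "\<exists>N0. \<forall>N\<ge>N0. ennreal (\<Sum>n<N. \<nu> (B \<inter> A n)) \<le> (\<Sum>n. ennreal (\<nu> (B \<inter> A n)))"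
        by blast
    qed
    also have "\<dots> \<le> (\<Sum>n. ?f (A n))"
      by (intro suminf_le SUP_upper) (use A B in auto)
    finally show "ennreal (\<nu> B) \<le> (\<Sum>n. ?f (A n))" .
  qed
  show ?thesis
    unfolding positive_part_def
    by (rule measure_space_borelI[where f = ?f, OF empty mono super sub A])
qed

lemma emeasure_total_variation:
  fixes \<mu> :: "'a::topological_space set \<Rightarrow> 'b::real_normed_vector"
  assumes \<mu>: "vector_measure \<mu>" and A: "A \<in> sets borel"
  shows "emeasure (total_variation \<mu>) A = (SUP P\<in>borel_partitions A. \<Sum>n. ennreal (norm (\<mu> (P n))))"
proof -
  let ?s = "\<lambda>P. \<Sum>n. ennreal (norm (\<mu> (P n)))"
  let ?f = "\<lambda>A. SUP P\<in>borel_partitions A. ?s P"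
  have ne: "borel_partitions A \<noteq> {}" if "A \<in> sets borel" for A :: "'a set"
  proof -
    have "disjoint_family (binaryset A {})"
      by (simp add: disjoint_family_on_def binaryset_def)
    then have "binaryset A {} \<in> borel_partitions A"
      using that by (simp add: borel_partitions_def range_binaryset_eq UN_binaryset_eq)
    then show ?thesis by auto
  qed
  have s0: "?s P = 0" if "P \<in> borel_partitions {}" for P
  proof -
    have "P n = {}" for n using that by (auto simp: borel_partitions_def)
    then show ?thesis by (simp add: vector_measure_empty[OF \<mu>])
  qed
  have empty: "?f {} = 0"
    using ne[of "{}"] by (simp only: s0 cong: SUP_cong) simp
  have super: "?f A + ?f B \<le> ?f (A \<union> B)"
    if A: "A \<in> sets borel" and B: "B \<in> sets borel" and AB: "A \<inter> B = {}" for A B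
  proof -
    have *: "?s P + ?s Q \<le> ?f (A \<union> B)" if P: "P \<in> borel_partitions A" and Q: "Q \<in> borel_partitions B" for P Q
    proof -
      define R where "R n = (if even n then P (n div 2) else Q (n div 2))" for n
      have dis: "P i \<inter> Q j = {}" for i j
        using P Q AB by (auto simp: borel_partitions_def)
      have "R \<in> borel_partitions (A \<union> B)"
      proof -
        have "range R \<subseteq> sets borel"
          using P Q by (auto simp: R_def borel_partitions_def)
        moreover have "disjoint_family R"
          unfolding disjoint_family_on_def
        proof (intro ballI impI)
          fix m n :: nat assume mn: "m \<noteq> n"
          then have "even m = even n \<Longrightarrow> m div 2 \<noteq> n div 2"
            by presburger
          then show "R m \<inter> R n = {}"
            using P Q dis[of "m div 2" "n div 2"] dis[of "n div 2" "m div 2"]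
            by (simp add: R_def borel_partitions_def disjoint_family_on_def Int_commute split: if_splits)
        qed
        moreover have "(\<Union>n. R n) = (\<Union>n. P n) \<union> (\<Union>n. Q n)"
        proof -
          have "R (2 * n) = P n" "R (2 * n + 1) = Q n" for n by (auto simp: R_def)
          then have "(\<Union>n. P n) \<union> (\<Union>n. Q n) \<subseteq> (\<Union>n. R n)" by blast
          moreover have "(\<Union>n. R n) \<subseteq> (\<Union>n. P n) \<union> (\<Union>n. Q n)"
            by (auto simp: R_def split: if_splits)
          ultimately show ?thesis by blast
        qed
        ultimately show ?thesis
          using P Q by (auto simp: borel_partitions_def)
      qed
      then have le: "?s R \<le> ?f (A \<union> B)" by (rule SUP_upper)
      have "(\<Sum>n<N. ennreal (norm (\<mu> (P n))) + ennreal (norm (\<mu> (Q n)))) \<le> ?s R" for N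
      proof -
        have "(\<Sum>n<N. ennreal (norm (\<mu> (P n))) + ennreal (norm (\<mu> (Q n))))
                = (\<Sum>n<2*N. ennreal (norm (\<mu> (R n))))"
          by (induction N) (simp_all add: R_def add.assoc)
        also have "\<dots> \<le> ?s R"
          by (rule sum_le_suminf) auto
        finally show ?thesis .
      qed
      then have "(\<Sum>n. ennreal (norm (\<mu> (P n))) + ennreal (norm (\<mu> (Q n)))) \<le> ?s R"
        by (intro suminf_le_const) auto
      then have "?s P + ?s Q \<le> ?s R"
        by (subst suminf_add) auto
      then show ?thesis using le by simp
    qed
    show ?thesis
      by (rule SUP_add_SUP_le[OF ne[OF A] ne[OF B] *])
  qed
  have mono: "?f A \<le> ?f B" if "A \<in> sets borel" "B \<in> sets borel" "A \<subseteq> B" for A B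
  proof -
    have "?f A \<le> ?f A + ?f (B - A)" by (rule add_increasing2) simp_all
    also have "\<dots> \<le> ?f (A \<union> (B - A))"
      by (rule super) (use that in auto)
    also have "A \<union> (B - A) = B" using that by auto
    finally show ?thesis .
  qed
  have sub: "?f (\<Union>n. A n) \<le> (\<Sum>n. ?f (A n))"
    if A: "range A \<subseteq> sets borel" "disjoint_family A" for A :: "nat \<Rightarrow> _"
  proof (rule SUP_least)
    fix P assume P: "P \<in> borel_partitions (\<Union>n. A n)"
    have bor: "P n \<in> sets borel" "A n \<in> sets borel" for n
      using P A by (auto simp: borel_partitions_def)
    have dP: "disjoint_family P" and UP: "(\<Union>n. P n) = (\<Union>n. A n)"
      using P by (auto simp: borel_partitions_def)
    have "ennreal (norm (\<mu> (P n))) \<le> (\<Sum>k. ennreal (norm (\<mu> (P n \<inter> A k))))" for n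
    proof (rule LIMSEQ_le_const2)
      have "(\<lambda>k. \<mu> (P n \<inter> A k)) sums \<mu> (\<Union>k. P n \<inter> A k)"
        by (rule vector_measure_sums[OF \<mu>])
           (use A(2) bor in \<open>auto simp: disjoint_family_on_def\<close>)
      also have "(\<Union>k. P n \<inter> A k) = P n"
        using UP by auto
      finally show "(\<lambda>N. ennreal (norm (\<Sum>k<N. \<mu> (P n \<inter> A k)))) \<longlonglongrightarrow> ennreal (norm (\<mu> (P n)))"
        by (intro tendsto_ennrealI tendsto_norm) (simp add: sums_def)
      have "ennreal (norm (\<Sum>k<N. \<mu> (P n \<inter> A k)))
              \<le> (\<Sum>k. ennreal (norm (\<mu> (P n \<inter> A k))))" for N
      proof -
        have "ennreal (norm (\<Sum>k<N. \<mu> (P n \<inter> A k))) \<le> (\<Sum>k<N. ennreal (norm (\<mu> (P n \<inter> A k))))"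
          by (subst sum_ennreal) (auto intro!: ennreal_leI norm_sum)
        also have "\<dots> \<le> (\<Sum>k. ennreal (norm (\<mu> (P n \<inter> A k))))"
          by (rule sum_le_suminf) auto
        finally show ?thesis .
      qed
      then show "\<exists>N0. \<forall>N\<ge>N0. ennreal (norm (\<Sum>k<N. \<mu> (P n \<inter> A k)))
                      \<le> (\<Sum>k. ennreal (norm (\<mu> (P n \<inter> A k))))"
        by blast
    qed
    then have "?s P \<le> (\<Sum>n. \<Sum>k. ennreal (norm (\<mu> (P n \<inter> A k))))"
      by (intro suminf_le) auto
    also have "\<dots> = (\<Sum>k. \<Sum>n. ennreal (norm (\<mu> (P n \<inter> A k))))"
      using nn_integral_fst_count_space[of "\<lambda>(n, k). ennreal (norm (\<mu> (P n \<inter> A k)))"]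
        nn_integral_snd_count_space[of "\<lambda>(n, k). ennreal (norm (\<mu> (P n \<inter> A k)))"]
      by (simp add: nn_integral_count_space_nat)
    also have "\<dots> \<le> (\<Sum>k. ?f (A k))"
    proof (intro suminf_le)
      fix k
      have "disjoint_family (\<lambda>n. P n \<inter> A k)"
        using dP unfolding disjoint_family_on_def by blast
      moreover have "(\<Union>n. P n \<inter> A k) = A k"
        using UP by blast
      ultimately have "(\<lambda>n. P n \<inter> A k) \<in> borel_partitions (A k)"
        using bor by (auto simp: borel_partitions_def)
      then show "(\<Sum>n. ennreal (norm (\<mu> (P n \<inter> A k)))) \<le> ?f (A k)"
        by (rule SUP_upper2) simp
    qed auto
    finally show "?s P \<le> (\<Sum>n. ?f (A n))" .
  qed
  show ?thesis
    unfolding total_variation_def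
    by (rule measure_space_borelI[where f = ?f, OF empty mono super sub A])
qed

definition signed_set_integral ::
    "('a::topological_space set \<Rightarrow> real) \<Rightarrow> 'a set \<Rightarrow> ('a \<Rightarrow> real) \<Rightarrow> real" where
  "signed_set_integral \<nu> A f =
     (LINT x:A|positive_part \<nu>. f x) - (LINT x:A|positive_part (\<lambda>B. - \<nu> B). f x)"

definition inner_integral_on ::
    "('a::topological_space set \<Rightarrow> real ^ 'm) \<Rightarrow> 'a set \<Rightarrow> ('a \<Rightarrow> real ^ 'm) \<Rightarrow> real" where
  "inner_integral_on \<mu> A u = (\<Sum>i\<in>UNIV. signed_set_integral (\<lambda>B. \<mu> B $ i) A (\<lambda>x. u x $ i))"

abbreviation inner_integral ::
    "('a::topological_space set \<Rightarrow> real ^ 'm) \<Rightarrow> ('a \<Rightarrow> real ^ 'm) \<Rightarrow> real" where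
  "inner_integral \<mu> u \<equiv> inner_integral_on \<mu> UNIV u"


section \<open>Transports and the Wasserstein space\<close>

definition marginal1 :: "(('a \<times> 'a) set \<Rightarrow> 'b) \<Rightarrow> 'a set \<Rightarrow> 'b" where
  "marginal1 \<pi> A = \<pi> (A \<times> UNIV)"

definition marginal2 :: "(('a \<times> 'a) set \<Rightarrow> 'b) \<Rightarrow> 'a set \<Rightarrow> 'b" where
  "marginal2 \<pi> A = \<pi> (UNIV \<times> A)"

definition transports ::
    "('a::topological_space set \<Rightarrow> 'b::real_normed_vector) \<Rightarrow> (('a \<times> 'a) set \<Rightarrow> 'b) set" where
  "transports \<mu> =
     {\<pi>. vector_measure \<pi> \<and> (\<forall>A\<in>sets borel. marginal1 \<pi> A - marginal2 \<pi> A = \<mu> A)}"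

definition wasserstein_space :: "('a::metric_space set \<Rightarrow> real ^ 'm) set" where
  "wasserstein_space =
     {\<mu>. vector_measure \<mu> \<and> \<mu> UNIV = 0 \<and>
         (\<exists>x0. (\<integral>\<^sup>+x. ennreal (dist x x0) \<partial>total_variation \<mu>) < \<infinity>)}"

text \<open>
  Costs take values in \<^typ>\<open>ennreal\<close>, since a transport may have infinite cost.
\<close>

definition transport_cost_on ::
    "(('a::metric_space \<times> 'a) set \<Rightarrow> 'b::real_normed_vector) \<Rightarrow> ('a \<times> 'a) set \<Rightarrow> ennreal" where
  "transport_cost_on \<pi> A = (\<integral>\<^sup>+(x, y)\<in>A. ennreal (dist x y) \<partial>total_variation \<pi>)"

abbreviation transport_cost ::
    "(('a::metric_space \<times> 'a) set \<Rightarrow> 'b::real_normed_vector) \<Rightarrow> ennreal" where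
  "transport_cost \<pi> \<equiv> transport_cost_on \<pi> UNIV"

definition wasserstein_norm :: "('a::metric_space set \<Rightarrow> real ^ 'm) \<Rightarrow> ennreal" where
  "wasserstein_norm \<mu> = (INF \<pi>\<in>transports \<mu>. transport_cost \<pi>)"

definition lipschitz_space :: "'a::metric_space \<Rightarrow> ('a \<Rightarrow> real ^ 'm) set" where
  "lipschitz_space x0 = {u. (\<exists>L. L-lipschitz_on UNIV u) \<and> u x0 = 0}"

definition optimal_potential ::
    "('a::metric_space set \<Rightarrow> real ^ 'm) \<Rightarrow> ('a \<Rightarrow> real ^ 'm) \<Rightarrow> bool" where
  "optimal_potential \<mu> u \<longleftrightarrow> 1-lipschitz_on UNIV u \<and>
     ereal (inner_integral \<mu> u) = (SUP v\<in>{v. 1-lipschitz_on UNIV v}. ereal (inner_integral \<mu> v))"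

definition optimal_transport ::
    "('a::metric_space set \<Rightarrow> real ^ 'm) \<Rightarrow> (('a \<times> 'a) set \<Rightarrow> real ^ 'm) \<Rightarrow> bool" where
  "optimal_transport \<mu> \<pi> \<longleftrightarrow> \<pi> \<in> transports \<mu> \<and> wasserstein_norm \<mu> = transport_cost \<pi>"

end

theory Submission
  imports Defs "HOL-Library.Function_Algebras"
begin

text \<open>
  Write \<open>\<Delta>u(x, y) = u x - u y\<close>. Every vector measure has a polar density: \<open>d\<pi> = k d\<parallel>\<pi>\<parallel>\<close> with
  \<open>\<parallel>k\<parallel> \<le> 1\<close> (\<open>polar_density_exists\<close>). If the transport \<open>\<pi>\<close> of \<open>\<mu>\<close> has finite cost, then
  \<open>\<integral>\<langle>u, d\<mu>\<rangle> = \<integral>\<langle>\<Delta>u, k\<rangle> d\<parallel>\<pi>\<parallel>\<close> (\<open>inner_integral_transport\<close>), and for a 1-Lipschitz \<open>u\<close> the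
  Cauchy-Schwarz inequality bounds the integrand by \<open>\<parallel>\<Delta>u\<parallel> \<le> d\<close>. This is weak duality: the integral
  of any 1-Lipschitz map against \<open>\<mu>\<close> is at most the cost of any transport
  (\<open>inner_integral_le_transport_cost\<close>). So (iii) makes \<open>\<pi>\<close> and \<open>u\<close> optimal, which gives (i) and
  (iv). It also makes the nonnegative function \<open>d - \<langle>\<Delta>u, k\<rangle>\<close> have integral zero, hence vanish
  almost everywhere; integrating over Borel sets gives (ii), and squeezing \<open>\<parallel>\<Delta>u\<parallel>\<close> between
  \<open>\<langle>\<Delta>u, k\<rangle>\<close> and \<open>d\<close> gives the final claim (\<open>tight_transport\<close>). Conversely (ii) with the whole
  space is (iii).

  The step from (iv) to (i) is strong duality: some 1-Lipschitz \<open>v\<close> has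
  \<open>\<integral>\<langle>v, d\<mu>\<rangle> \<ge> \<parallel>\<mu>\<parallel>\<^sub>W\<close> (\<open>strong_duality\<close>). The Wasserstein norm is a seminorm on the space of set
  functions that admit a transport of finite cost, so Hahn-Banach gives a linear functional \<open>l\<close>
  below it with \<open>l \<mu> = \<parallel>\<mu>\<parallel>\<^sub>W\<close>. Evaluating \<open>l\<close> on differences of vector-valued point masses defines
  \<open>v\<close>, and \<open>v\<close> is 1-Lipschitz because moving a mass \<open>c\<close> from \<open>x\<close> to \<open>y\<close> costs at most
  \<open>\<parallel>c\<parallel> d(x, y)\<close>. On
  finitely supported measures \<open>l\<close> is integration of \<open>v\<close>; the push-forwards of \<open>\<mu>\<close> under finitely
  valued maps \<open>T\<close> close to the identity are such measures, and they approximate \<open>\<mu>\<close> since \<open>\<mu>\<close> is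
  transported to its image under \<open>T\<close> at cost at most \<open>\<integral>d(x, T x) d\<parallel>\<mu>\<parallel>\<close>.
\<close>


section \<open>Total variation and Jordan decomposition\<close>

lemma sets_total_variation [simp, measurable_cong]: "sets (total_variation \<mu>) = sets borel"
  unfolding total_variation_def
  using sets.sigma_sets_eq[of "borel :: 'a measure"] by (subst sets_measure_of) auto

lemma space_total_variation [simp]: "space (total_variation \<mu>) = UNIV"
  by (simp add: total_variation_def space_measure_of_conv)

lemma sets_positive_part [simp, measurable_cong]: "sets (positive_part \<nu>) = sets borel"
  unfolding positive_part_def
  using sets.sigma_sets_eq[of "borel :: 'a measure"] by (subst sets_measure_of) auto

lemma space_positive_part [simp]: "space (positive_part \<nu>) = UNIV"
  by (simp add: positive_part_def space_measure_of_conv)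

text \<open>
  An inequality between a measure and a positive combination of measures passes to integrals. Both
  the triangle inequality for transport costs and comparisons of a single pair of measures are
  instances.
\<close>

lemma nn_integral_le_lincomb:
  fixes c :: "'i \<Rightarrow> ennreal"
  assumes sets: "\<And>i. i \<in> I \<Longrightarrow> sets (M i) = sets K"
    and le: "\<And>A. A \<in> sets K \<Longrightarrow> emeasure K A \<le> (\<Sum>i\<in>I. c i * emeasure (M i) A)"
    and f: "f \<in> borel_measurable K"
  shows "(\<integral>\<^sup>+x. f x \<partial>K) \<le> (\<Sum>i\<in>I. c i * (\<integral>\<^sup>+x. f x \<partial>M i))"
  using f
proof (induction rule: borel_measurable_induct)
  case (cong f g)
  have "(\<integral>\<^sup>+x. f x \<partial>M i) = (\<integral>\<^sup>+x. g x \<partial>M i)" if "i \<in> I" for i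
    using sets_eq_imp_space_eq[OF sets[OF that]] cong(3) by (intro nn_integral_cong) simp
  moreover have "(\<integral>\<^sup>+x. f x \<partial>K) = (\<integral>\<^sup>+x. g x \<partial>K)"
    using cong(3) by (intro nn_integral_cong) simp
  ultimately show ?case
    using cong(4) by simp
next
  case (set A)
  then show ?case
    using le[OF set] sets by simp
next
  case (mult u a)
  have "(\<integral>\<^sup>+x. a * u x \<partial>K) = a * (\<integral>\<^sup>+x. u x \<partial>K)"
    by (rule nn_integral_cmult) fact
  also have "\<dots> \<le> a * (\<Sum>i\<in>I. c i * (\<integral>\<^sup>+x. u x \<partial>M i))"
    by (intro mult_left_mono mult) simp
  also have "\<dots> = (\<Sum>i\<in>I. c i * (\<integral>\<^sup>+x. a * u x \<partial>M i))"
    using mult(2) by (auto simp: sum_distrib_left nn_integral_cmult measurable_cong_sets[OF sets refl] ac_simps intro!: sum.cong)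
  finally show ?case .
next
  case (add u v)
  have "(\<integral>\<^sup>+x. v x + u x \<partial>K) = (\<integral>\<^sup>+x. v x \<partial>K) + (\<integral>\<^sup>+x. u x \<partial>K)"
    by (rule nn_integral_add) fact+
  also have "\<dots> \<le> (\<Sum>i\<in>I. c i * (\<integral>\<^sup>+x. v x \<partial>M i)) + (\<Sum>i\<in>I. c i * (\<integral>\<^sup>+x. u x \<partial>M i))"
    by (intro add_mono add)
  also have "\<dots> = (\<Sum>i\<in>I. c i * (\<integral>\<^sup>+x. v x + u x \<partial>M i))"
    unfolding sum.distrib[symmetric]
    using add.hyps(1,3) by (intro sum.cong refl) (simp add: nn_integral_add measurable_cong_sets[OF sets refl] distrib_left)
  finally show ?case .
next
  case (seq U)
  have "(\<integral>\<^sup>+x. (SUP i. U i) x \<partial>K) = (SUP n. \<integral>\<^sup>+x. U n x \<partial>K)"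
    using nn_integral_monotone_convergence_SUP[OF \<open>incseq U\<close> seq.hyps(1)] by (simp add: image_comp)
  also have "\<dots> \<le> (\<Sum>i\<in>I. c i * (\<integral>\<^sup>+x. (SUP i. U i) x \<partial>M i))"
  proof (rule SUP_least)
    fix n
    have "U n x \<le> (SUP i. U i) x" for x
      by (auto intro: SUP_upper)
    then have "(\<Sum>i\<in>I. c i * (\<integral>\<^sup>+x. U n x \<partial>M i)) \<le> (\<Sum>i\<in>I. c i * (\<integral>\<^sup>+x. (SUP i. U i) x \<partial>M i))"
      by (intro sum_mono mult_left_mono nn_integral_mono) auto
    then show "(\<integral>\<^sup>+x. U n x \<partial>K) \<le> (\<Sum>i\<in>I. c i * (\<integral>\<^sup>+x. (SUP i. U i) x \<partial>M i))"
      using seq.IH[of n] by (rule order_trans[rotated])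
  qed
  finally show ?case .
qed

lemma nn_integral_mono_emeasure:
  assumes "sets M = sets K" "\<And>A. A \<in> sets K \<Longrightarrow> emeasure K A \<le> emeasure M A"
    and "f \<in> borel_measurable K"
  shows "(\<integral>\<^sup>+x. f x \<partial>K) \<le> (\<integral>\<^sup>+x. f x \<partial>M)"
  using nn_integral_le_lincomb[of "{()}" "\<lambda>_. M" K "\<lambda>_. 1" f] assms by simp

lemma norm_le_total_variation:
  assumes \<mu>: "vector_measure \<mu>" and A: "A \<in> sets borel"
  shows "ennreal (norm (\<mu> A)) \<le> emeasure (total_variation \<mu>) A"
proof -
  have P: "binaryset A {} \<in> borel_partitions A"
    using A by (auto simp: borel_partitions_def range_binaryset_eq UN_binaryset_eq
        disjoint_family_on_def binaryset_def)
  define f where "f n = ennreal (norm (\<mu> (binaryset A {} n)))" for n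
  have "sum f {0} \<le> suminf f"
    by (intro sum_le_suminf) auto
  also have "sum f {0} = ennreal (norm (\<mu> A))"
    by (simp add: f_def binaryset_def)
  finally show ?thesis
    unfolding emeasure_total_variation[OF assms] f_def
    by (rule SUP_upper2[OF P])
qed

text \<open>
  The total variation is the least measure dominating the norm. The dominating measure is
  given as a combination of measures, the form in which it occurs for sums, multiples and
  push-forwards of vector measures.
\<close>

lemma total_variation_least:
  assumes \<mu>: "vector_measure \<mu>" and A: "A \<in> sets borel"
    and sets: "\<And>i. i \<in> I \<Longrightarrow> sets (M i) = sets borel"
    and le: "\<And>B. B \<in> sets borel \<Longrightarrow> ennreal (norm (\<mu> B)) \<le> (\<Sum>i\<in>I. c i * emeasure (M i) B)"
  shows "emeasure (total_variation \<mu>) A \<le> (\<Sum>i\<in>I. c i * emeasure (M i) A)"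
  unfolding emeasure_total_variation[OF \<mu> A]
proof (rule SUP_least)
  fix P assume P: "P \<in> borel_partitions A"
  have "(\<Sum>n. ennreal (norm (\<mu> (P n)))) \<le> (\<Sum>n. \<Sum>i\<in>I. c i * emeasure (M i) (P n))"
    using P by (intro suminf_le le) (auto simp: borel_partitions_def)
  also have "\<dots> = (\<Sum>i\<in>I. \<Sum>n. c i * emeasure (M i) (P n))"
    by (rule suminf_sum) simp
  also have "\<dots> = (\<Sum>i\<in>I. c i * emeasure (M i) A)"
  proof (intro sum.cong refl)
    fix i assume "i \<in> I"
    then have "(\<Sum>n. emeasure (M i) (P n)) = emeasure (M i) (\<Union>n. P n)"
      using P sets by (intro suminf_emeasure) (auto simp: borel_partitions_def)
    then show "(\<Sum>n. c i * emeasure (M i) (P n)) = c i * emeasure (M i) A"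
      using P by (simp add: borel_partitions_def)
  qed
  finally show "(\<Sum>n. ennreal (norm (\<mu> (P n)))) \<le> (\<Sum>i\<in>I. c i * emeasure (M i) A)" .
qed

lemma vector_measure_Diff:
  assumes "vector_measure \<mu>" "A \<in> sets borel" "B \<in> sets borel" "B \<subseteq> A"
  shows "\<mu> (A - B) = \<mu> A - \<mu> B"
  using vector_measure_Un[OF assms(1), of "A - B" B] assms
  by (simp add: Un_absorb2 Diff_Int_distrib2)

text \<open>
  Call a set bad if the measure is unbounded on its subsets. A bad set \<open>E\<close> has a subset \<open>B\<close> whose
  value is so large that both \<open>B\<close> and \<open>E - B\<close> have norm at least 1, and one of them is again bad. If
  the whole space were bad, splitting off such pieces forever would give disjoint sets whose values
  do not tend to zero, contradicting countable additivity.
\<close>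

lemma vector_measure_bounded_range:
  assumes \<mu>: "vector_measure \<mu>"
  obtains C where "\<And>A. A \<in> sets borel \<Longrightarrow> norm (\<mu> A) \<le> C"
proof -
  define bad where
    "bad E \<longleftrightarrow> E \<in> sets borel \<and> (\<forall>C. \<exists>B\<in>sets borel. B \<subseteq> E \<and> C < norm (\<mu> B))" for E
  have step: "\<exists>E'. bad E' \<and> E' \<subseteq> E \<and> 1 \<le> norm (\<mu> (E - E'))" if E: "bad E" for E
  proof -
    obtain B where B: "B \<in> sets borel" "B \<subseteq> E" "norm (\<mu> E) + 1 < norm (\<mu> B)"
      using E unfolding bad_def by blast
    have Eb: "E \<in> sets borel" using E by (simp add: bad_def)
    have "norm (\<mu> B) \<le> norm (\<mu> E) + norm (\<mu> (E - B))"
      unfolding vector_measure_Diff[OF \<mu> Eb B(1,2)]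
      by (metis add_diff_cancel_left' diff_diff_eq2 norm_triangle_ineq4)
    then have diff: "1 \<le> norm (\<mu> (E - B))" using B by simp
    have "bad B \<or> bad (E - B)"
    proof (rule ccontr)
      assume "\<not> ?thesis"
      then obtain C1 C2 where C: "\<And>D. D \<in> sets borel \<Longrightarrow> D \<subseteq> B \<Longrightarrow> norm (\<mu> D) \<le> C1"
          "\<And>D. D \<in> sets borel \<Longrightarrow> D \<subseteq> E - B \<Longrightarrow> norm (\<mu> D) \<le> C2"
        using B Eb unfolding bad_def by (meson linorder_not_less sets.Diff)
      have "norm (\<mu> D) \<le> C1 + C2" if D: "D \<in> sets borel" "D \<subseteq> E" for D
      proof -
        have "\<mu> D = \<mu> (D \<inter> B) + \<mu> (D - B)"
          using vector_measure_Un[OF \<mu>, of "D \<inter> B" "D - B"] D B by (simp add: Int_Diff_Un Int_Diff_disjoint)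
        moreover have "norm (\<mu> (D \<inter> B)) \<le> C1" "norm (\<mu> (D - B)) \<le> C2"
          using D B by (intro C; auto)+
        ultimately show ?thesis
          by (simp add: norm_triangle_mono)
      qed
      then show False
        using E unfolding bad_def by (meson linorder_not_less)
    qed
    moreover have "E - (E - B) = B"
      using B(2) by blast
    moreover have "1 \<le> norm (\<mu> B)"
      using B(3) norm_ge_zero[of "\<mu> E"] by linarith
    ultimately show ?thesis
      using B(2) diff by (metis Diff_subset)
  qed
  have "\<not> bad UNIV"
  proof
    assume "bad UNIV"
    then have "\<exists>E. \<forall>n. bad (E n) \<and> (E (Suc n) \<subseteq> E n \<and> 1 \<le> norm (\<mu> (E n - E (Suc n))))"
      using step by (intro dependent_nat_choice) auto
    then obtain E where E: "\<And>n. bad (E n)" "\<And>n. E (Suc n) \<subseteq> E n"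
        "\<And>n. 1 \<le> norm (\<mu> (E n - E (Suc n)))"
      by blast
    have anti: "m \<le> n \<Longrightarrow> E n \<subseteq> E m" for m n
      using E(2) by (rule lift_Suc_antimono_le)
    have dis: "(E m - E (Suc m)) \<inter> (E n - E (Suc n)) = {}" if "m < n" for m n
      using anti[of "Suc m" n] that by auto
    have "disjoint_family (\<lambda>n. E n - E (Suc n))"
      unfolding disjoint_family_on_def using dis by (metis Int_commute linorder_neqE_nat)
    then have "(\<lambda>n. \<mu> (E n - E (Suc n))) sums \<mu> (\<Union>n. E n - E (Suc n))"
      using E(1) by (intro vector_measure_sums[OF \<mu>]) (auto simp: bad_def)
    then have "(\<lambda>n. norm (\<mu> (E n - E (Suc n)))) \<longlonglongrightarrow> 0"
      by (intro tendsto_norm_zero summable_LIMSEQ_zero) (rule sums_summable)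
    then have "1 \<le> (0::real)"
      by (rule LIMSEQ_le_const) (use E(3) in auto)
    then show False by simp
  qed
  then show thesis
    using that unfolding bad_def by (metis linorder_not_less sets.top space_borel subset_UNIV)
qed

lemma vector_measure_component:
  fixes \<mu> :: "'a::topological_space set \<Rightarrow> real ^ 'm"
  assumes "vector_measure \<mu>"
  shows "vector_measure (\<lambda>A. \<mu> A $ i)"
  unfolding vector_measure_def
  using bounded_linear.sums[OF bounded_linear_vec_nth] vector_measure_sums[OF assms] by blast

lemma vector_measure_uminus:
  "vector_measure \<mu> \<Longrightarrow> vector_measure (\<lambda>A. - \<mu> A)"
  by (auto simp: vector_measure_def intro: sums_minus)

lemma finite_measure_positive_part:
  assumes "vector_measure \<nu>"
  shows "finite_measure (positive_part \<nu>)"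
proof -
  obtain C where C: "\<And>A. A \<in> sets borel \<Longrightarrow> norm (\<nu> A) \<le> C"
    using vector_measure_bounded_range[OF assms] by blast
  have "emeasure (positive_part \<nu>) UNIV \<le> ennreal C"
    unfolding emeasure_positive_part[OF assms, of UNIV, simplified]
    using C by (intro SUP_least ennreal_leI) (auto simp: abs_le_iff)
  then show ?thesis
    by (intro finite_measureI) (auto simp: top_unique)
qed

text \<open>
  For \<open>B \<subseteq> A\<close> one has \<open>\<nu> B = \<nu> A + (- \<nu> (A - B))\<close>; taking suprema over \<open>B\<close> turns the
  left side into the positive part of \<open>A\<close> and the last term into the negative part, and both are
  finite.
\<close>

lemma jordan_decomposition:
  assumes \<nu>: "vector_measure \<nu>" and A: "A \<in> sets borel"
  shows "\<nu> A = measure (positive_part \<nu>) A - measure (positive_part (\<lambda>B. - \<nu> B)) A"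
proof -
  have le: "measure (positive_part \<nu>) A \<le> \<nu> A + measure (positive_part (\<lambda>B. - \<nu> B)) A"
    if \<nu>: "vector_measure \<nu>" for \<nu>
  proof -
    interpret P: finite_measure "positive_part \<nu>"
      by (rule finite_measure_positive_part[OF \<nu>])
    interpret N: finite_measure "positive_part (\<lambda>B. - \<nu> B)"
      by (rule finite_measure_positive_part[OF vector_measure_uminus[OF \<nu>]])
    have bound: "\<nu> B \<le> \<nu> A + measure (positive_part (\<lambda>B. - \<nu> B)) A" if B: "B \<in> sets borel" "B \<subseteq> A" for B
    proof -
      have "ennreal (- \<nu> (A - B)) \<le> emeasure (positive_part (\<lambda>B. - \<nu> B)) A"
        unfolding emeasure_positive_part[OF vector_measure_uminus[OF \<nu>] A]
        by (rule SUP_upper) (use A B in auto)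
      then have "- \<nu> (A - B) \<le> measure (positive_part (\<lambda>B. - \<nu> B)) A"
        by (simp add: N.emeasure_eq_measure)
      then show ?thesis
        using vector_measure_Diff[OF \<nu> A B] by simp
    qed
    have "0 \<le> \<nu> A + measure (positive_part (\<lambda>B. - \<nu> B)) A"
      using bound[of "{}"] vector_measure_empty[OF \<nu>] by simp
    have "emeasure (positive_part \<nu>) A \<le> ennreal (\<nu> A + measure (positive_part (\<lambda>B. - \<nu> B)) A)"
      unfolding emeasure_positive_part[OF \<nu> A]
      using bound by (intro SUP_least ennreal_leI) auto
    then show ?thesis
      using \<open>0 \<le> \<nu> A + measure (positive_part (\<lambda>B. - \<nu> B)) A\<close> by (simp add: P.emeasure_eq_measure)
  qed
  show ?thesis
    using le[OF \<nu>] le[OF vector_measure_uminus[OF \<nu>]] by simp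
qed

lemma positive_part_component_le:
  fixes \<mu> :: "'a::topological_space set \<Rightarrow> real ^ 'm"
  assumes \<mu>: "vector_measure \<mu>" and A: "A \<in> sets borel" and s: "\<bar>s\<bar> = 1"
  shows "emeasure (positive_part (\<lambda>B. s * \<mu> B $ i)) A \<le> emeasure (total_variation \<mu>) A"
proof -
  have vm: "vector_measure (\<lambda>B. s * \<mu> B $ i)"
    using vector_measure_component[OF \<mu>, of i] by (auto simp: vector_measure_def intro: sums_mult)
  show ?thesis
    unfolding emeasure_positive_part[OF vm A]
  proof (intro SUP_least)
    fix B assume B: "B \<in> {B \<in> sets borel. B \<subseteq> A}"
    have "s * \<mu> B $ i \<le> norm (\<mu> B)"
      using component_le_norm_cart[of "\<mu> B" i] s
      by (metis abs_ge_self abs_mult mult_1 order_trans)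
    then have "ennreal (s * \<mu> B $ i) \<le> ennreal (norm (\<mu> B))"
      by (rule ennreal_leI)
    also have "\<dots> \<le> emeasure (total_variation \<mu>) B"
      using B by (intro norm_le_total_variation \<mu>) auto
    also have "\<dots> \<le> emeasure (total_variation \<mu>) A"
      using B A by (intro emeasure_mono) auto
    finally show "ennreal (s * \<mu> B $ i) \<le> emeasure (total_variation \<mu>) A" .
  qed
qed

text \<open>
  The norm of a vector is at most the sum of the moduli of its coordinates, and each coordinate is
  dominated by its positive and negative parts, which are finite.
\<close>

lemma finite_measure_total_variation:
  fixes \<mu> :: "'a::topological_space set \<Rightarrow> real ^ 'm"
  assumes \<mu>: "vector_measure \<mu>"
  shows "finite_measure (total_variation \<mu>)"
proof -
  define M where "M = (\<lambda>(i, b). positive_part (\<lambda>A. if b then \<mu> A $ i else - \<mu> A $ i))"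
  have M: "finite_measure (M p)" for p
    using finite_measure_positive_part[OF vector_measure_component[OF \<mu>]]
      finite_measure_positive_part[OF vector_measure_uminus[OF vector_measure_component[OF \<mu>]]]
    by (cases p; cases "snd p") (auto simp: M_def)
  have sets_M: "sets (M p) = sets borel" for p
    by (simp add: M_def split: prod.split)
  have "ennreal (norm (\<mu> B)) \<le> (\<Sum>p\<in>UNIV. 1 * emeasure (M p) B)" if B: "B \<in> sets borel" for B
  proof -
    have "norm (\<mu> B) \<le> (\<Sum>i\<in>UNIV. \<bar>\<mu> B $ i\<bar>)"
      by (rule norm_le_l1_cart)
    also have "\<dots> \<le> (\<Sum>i\<in>UNIV. \<Sum>b\<in>UNIV. measure (M (i, b)) B)"
    proof (rule sum_mono)
      fix i
      show "\<bar>\<mu> B $ i\<bar> \<le> (\<Sum>b\<in>UNIV. measure (M (i, b)) B)"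
        using jordan_decomposition[OF vector_measure_component[OF \<mu>] B, of i]
        by (simp add: M_def UNIV_bool abs_le_iff)
    qed
    also have "\<dots> = (\<Sum>p\<in>UNIV. measure (M p) B)"
      by (simp add: sum.cartesian_product)
    finally show ?thesis
      using M by (simp add: finite_measure.emeasure_eq_measure ennreal_leI)
  qed
  then have "emeasure (total_variation \<mu>) UNIV \<le> (\<Sum>p\<in>UNIV. 1 * emeasure (M p) UNIV)"
    by (intro total_variation_least[OF \<mu>]) (auto simp: sets_M)
  also have "\<dots> < \<infinity>"
    using M by (simp add: finite_measure.emeasure_eq_measure)
  finally show ?thesis
    by (intro finite_measureI) auto
qed


section \<open>Polar decomposition of a vector measure\<close>

text \<open>
  The Radon-Nikodym theorem in the form needed for integrals: a finite real density that
  computes all integrals of functions integrable with respect to the dominating measure.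
\<close>

lemma dominated_density:
  assumes T: "finite_measure T" and sets[measurable_cong]: "sets K = sets T"
    and le: "\<And>A. A \<in> sets T \<Longrightarrow> emeasure K A \<le> emeasure T A"
  shows "\<exists>g::'a \<Rightarrow> real. g \<in> borel_measurable T \<and>
      (\<forall>f. integrable T f \<longrightarrow> integrable T (\<lambda>x. g x * f x) \<and> (\<integral>x. f x \<partial>K) = (\<integral>x. g x * f x \<partial>T))"
proof -
  interpret T: finite_measure T by fact
  have "emeasure K (space K) < \<infinity>"
    using le[of "space T"] sets_eq_imp_space_eq[OF sets] by (auto simp: T.emeasure_eq_measure le_less_trans)
  then interpret K: finite_measure K
    by (intro finite_measureI) auto
  have ac: "absolutely_continuous T K"
    unfolding absolutely_continuous_def using le sets by (force simp: null_sets_def)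
  define g where "g x = enn2real (RN_deriv T K x)" for x
  have g[measurable]: "g \<in> borel_measurable T"
    by (simp add: g_def[abs_def])
  have "AE x in T. RN_deriv T K x = ennreal (g x)"
    using T.RN_deriv_finite[OF K.sigma_finite_measure_axioms ac sets] by eventually_elim (simp add: g_def less_top)
  then have "density T g = density T (RN_deriv T K)"
    by (intro density_cong) auto
  then have K: "K = density T g"
    using T.density_RN_deriv[OF ac sets] by simp
  have g0: "0 \<le> g x" for x
    by (simp add: g_def)
  have "integrable T (\<lambda>x. g x * f x) \<and> (\<integral>x. f x \<partial>K) = (\<integral>x. g x * f x \<partial>T)"
    if f: "integrable T f" for f :: "'a \<Rightarrow> real"
  proof -
    have [measurable]: "f \<in> borel_measurable T" using f by simp
    have "(\<integral>\<^sup>+x. ennreal (norm (f x)) \<partial>K) \<le> (\<integral>\<^sup>+x. ennreal (norm (f x)) \<partial>T)"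
      using sets by (intro nn_integral_mono_emeasure) (auto intro: le)
    also have "\<dots> < \<infinity>"
      using f by (simp add: integrable_iff_bounded)
    finally have "integrable K f"
      by (simp add: integrable_iff_bounded)
    then show ?thesis
      using g0 unfolding K by (subst (asm) integrable_density) (auto simp: integral_density)
  qed
  with g show ?thesis by blast
qed

text \<open>
  Testing with a vector \<open>c\<close> shows \<open>\<langle>c, h\<rangle> \<le> \<parallel>c\<parallel>\<close> almost everywhere, simultaneously for all \<open>c\<close> in a
  countable dense set. A value with \<open>\<parallel>h x\<parallel> > 1\<close> violates this for \<open>c = h x\<close>, hence for all \<open>c\<close>
  near \<open>h x\<close>.
\<close>

lemma norm_le_1_of_integral_le:
  fixes h :: "'a \<Rightarrow> 'b::euclidean_space"
  assumes T: "finite_measure T" and h: "integrable T h"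
    and le: "\<And>A. A \<in> sets T \<Longrightarrow> norm (\<integral>x. indicator A x *\<^sub>R h x \<partial>T) \<le> measure T A"
  shows "AE x in T. norm (h x) \<le> 1"
proof -
  interpret T: finite_measure T by fact
  have [measurable]: "h \<in> borel_measurable T" using h by simp
  have AE_c: "AE x in T. c \<bullet> h x \<le> norm c" for c
  proof -
    define A where "A = {x \<in> space T. norm c < c \<bullet> h x}"
    have A[measurable]: "A \<in> sets T" unfolding A_def by measurable
    define f where "f x = c \<bullet> (indicator A x *\<^sub>R h x) - norm c * indicator A x" for x
    have hA: "integrable T (\<lambda>x. indicator A x *\<^sub>R h x)"
      using h by (rule integrable_mult_indicator[OF A])
    have iA: "integrable T (\<lambda>x. norm c * indicator A x)"
      by (simp add: T.emeasure_eq_measure)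
    have f: "integrable T f"
      unfolding f_def using hA iA by (intro Bochner_Integration.integrable_diff integrable_inner_right) auto
    have nn: "AE x in T. 0 \<le> f x"
      by (rule AE_I2) (auto simp: f_def A_def indicator_def)
    have "integral\<^sup>L T f = (\<integral>x. c \<bullet> (indicator A x *\<^sub>R h x) \<partial>T) - (\<integral>x. norm c * indicator A x \<partial>T)"
      unfolding f_def by (rule Bochner_Integration.integral_diff[OF integrable_inner_right[OF hA] iA])
    also have "(\<integral>x. c \<bullet> (indicator A x *\<^sub>R h x) \<partial>T) = c \<bullet> (\<integral>x. indicator A x *\<^sub>R h x \<partial>T)"
      by (rule integral_inner_right[OF hA])
    also have "(\<integral>x. norm c * indicator A x \<partial>T) = norm c * measure T A"
      using A by (simp add: sets.Int_space_eq2)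
    also have "c \<bullet> (\<integral>x. indicator A x *\<^sub>R h x \<partial>T) - norm c * measure T A \<le> 0"
    proof -
      have "c \<bullet> (\<integral>x. indicator A x *\<^sub>R h x \<partial>T) \<le> norm c * norm (\<integral>x. indicator A x *\<^sub>R h x \<partial>T)"
        by (rule norm_cauchy_schwarz)
      also have "\<dots> \<le> norm c * measure T A"
        by (intro mult_left_mono le A) simp
      finally show ?thesis by simp
    qed
    finally have "integral\<^sup>L T f = 0"
      using integral_nonneg_AE[OF nn] by simp
    then have "AE x in T. f x = 0"
      using integral_nonneg_eq_0_iff_AE[OF f nn] by simp
    then show ?thesis
      using AE_space by eventually_elim (auto simp: f_def A_def indicator_def split: if_splits)
  qed
  obtain D :: "'b set" where D: "countable D" "\<And>X. open X \<Longrightarrow> X \<noteq> {} \<Longrightarrow> \<exists>d\<in>D. d \<in> X"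
    by (erule countable_dense_setE)
  have "AE x in T. \<forall>c\<in>D. c \<bullet> h x \<le> norm c"
    using AE_c D(1) by (simp add: AE_ball_countable)
  then show ?thesis
  proof eventually_elim
    case (elim x)
    show ?case
    proof (rule ccontr)
      assume *: "\<not> norm (h x) \<le> 1"
      have "open {c. norm c < c \<bullet> h x}"
        by (intro open_Collect_less continuous_intros)
      moreover have "norm (h x) < h x \<bullet> h x"
      proof -
        have "1 * norm (h x) < norm (h x) * norm (h x)"
          using * by (intro mult_strict_right_mono) linarith+
        then show ?thesis
          by (simp add: dot_square_norm power2_eq_square)
      qed
      ultimately obtain c where "c \<in> D" "norm c < c \<bullet> h x"
        using D(2)[of "{c. norm c < c \<bullet> h x}"] by auto
      with elim show False by auto
    qed
  qed
qed

text \<open>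
  The density of a vector measure with respect to its total variation. The bound on the norm holds
  at every point, so that Cauchy-Schwarz applies pointwise; the last clause turns integrals defined
  by the Jordan decompositions of the coordinates into integrals against a single positive measure.
\<close>

definition polar_density :: "('a::topological_space set \<Rightarrow> real ^ 'm) \<Rightarrow> ('a \<Rightarrow> real ^ 'm) \<Rightarrow> bool" where
  "polar_density \<mu> h \<longleftrightarrow> h \<in> borel_measurable borel \<and> (\<forall>x. norm (h x) \<le> 1) \<and>
     (\<forall>A\<in>sets borel. \<mu> A = (LINT x:A|total_variation \<mu>. h x)) \<and>
     (\<forall>A\<in>sets borel. \<forall>u. set_integrable (total_variation \<mu>) A u \<longrightarrow>
        inner_integral_on \<mu> A u = (LINT x:A|total_variation \<mu>. u x \<bullet> h x))"

text \<open>
  The positive and negative parts of the coordinates are dominated by the total variation, so they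
  have densities. These assemble to a density \<open>h0\<close>, and \<open>\<parallel>\<mu> A\<parallel> \<le> \<parallel>\<mu>\<parallel>(A)\<close> for all \<open>A\<close> forces
  \<open>\<parallel>h0\<parallel> \<le> 1\<close> almost everywhere; setting \<open>h0\<close> to zero elsewhere gives the bound everywhere.
\<close>

lemma polar_density_exists:
  fixes \<mu> :: "'a::topological_space set \<Rightarrow> real ^ 'm"
  assumes \<mu>: "vector_measure \<mu>"
  obtains h where "polar_density \<mu> h"
proof -
  let ?T = "total_variation \<mu>"
  interpret T: finite_measure ?T
    by (rule finite_measure_total_variation[OF \<mu>])
  define P where "P i s = positive_part (\<lambda>B. (if s then \<mu> B $ i else - \<mu> B $ i))" for i s
  have sets_P [measurable_cong]: "sets (P i s) = sets borel" for i s
    by (cases s) (auto simp: P_def)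
  have P_le: "emeasure (P i s) A \<le> emeasure ?T A" if "A \<in> sets borel" for i s A
    using positive_part_component_le[OF \<mu> that, of 1 i] positive_part_component_le[OF \<mu> that, of "-1" i]
    by (cases s) (auto simp: P_def)
  \<comment> \<open>\<open>g i s\<close> is the density of the positive part (\<open>s = True\<close>) or the negative part (\<open>s = False\<close>) of
    coordinate \<open>i\<close>.\<close>
  let ?dens = "\<lambda>i s g. g \<in> borel_measurable ?T \<and>
      (\<forall>f::'a \<Rightarrow> real. integrable ?T f \<longrightarrow> integrable ?T (\<lambda>x. g x * f x) \<and>
        (\<integral>x. f x \<partial>P i s) = (\<integral>x. g x * f x \<partial>?T))"
  define g where "g i s = (SOME g. ?dens i s g)" for i s
  have ex: "\<exists>g. ?dens i s g" for i s
    by (rule dominated_density[OF T.finite_measure_axioms]) (simp_all add: sets_P P_le)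
  have "?dens i s (g i s)" for i s
    unfolding g_def by (rule someI_ex[OF ex])
  then have g_meas[measurable]: "\<And>i s. g i s \<in> borel_measurable ?T"
    and g_int: "\<And>i s f. integrable ?T f \<Longrightarrow> integrable ?T (\<lambda>x. g i s x * f x)"
    and g_eq: "\<And>i s f. integrable ?T f \<Longrightarrow> (\<integral>x. f x \<partial>P i s) = (\<integral>x. g i s x * f x \<partial>?T)"
    by blast+
  define h0 where "h0 x = (\<Sum>i\<in>UNIV. (g i True x - g i False x) *\<^sub>R (axis i 1 :: real ^ 'm))" for x
  have h0_nth: "h0 x $ i = g i True x - g i False x" for x i
    by (simp add: h0_def axis_def if_distrib if_distribR cong: if_cong)
  have g1: "integrable ?T (\<lambda>x. g i s x)" for i s
    using g_int[of "\<lambda>_. 1" i s] by simp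
  have h0_int: "integrable ?T h0"
    unfolding h0_def using g1 by (intro Bochner_Integration.integrable_sum integrable_scaleR_left) auto
  have signed: "signed_set_integral (\<lambda>B. \<mu> B $ i) A f = (\<integral>x. indicator A x * (h0 x $ i * f x) \<partial>?T)"
    "integrable ?T (\<lambda>x. indicator A x * (h0 x $ i * f x))"
    if A: "A \<in> sets borel" and f: "set_integrable ?T A f" for A i and f :: "'a \<Rightarrow> real"
  proof -
    have f': "integrable ?T (\<lambda>x. indicator A x * f x)"
      using f by (simp add: set_integrable_def)
    have "signed_set_integral (\<lambda>B. \<mu> B $ i) A f
        = (\<integral>x. g i True x * (indicator A x * f x) \<partial>?T) - (\<integral>x. g i False x * (indicator A x * f x) \<partial>?T)"
      using g_eq[OF f', of i True] g_eq[OF f', of i False]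
      by (simp add: signed_set_integral_def set_lebesgue_integral_def P_def)
    also have "\<dots> = (\<integral>x. g i True x * (indicator A x * f x) - g i False x * (indicator A x * f x) \<partial>?T)"
      by (rule Bochner_Integration.integral_diff[symmetric]; rule g_int[OF f'])
    also have "\<dots> = (\<integral>x. indicator A x * (h0 x $ i * f x) \<partial>?T)"
      by (simp add: h0_nth algebra_simps)
    finally show "signed_set_integral (\<lambda>B. \<mu> B $ i) A f = (\<integral>x. indicator A x * (h0 x $ i * f x) \<partial>?T)" .
    have "integrable ?T (\<lambda>x. g i True x * (indicator A x * f x) - g i False x * (indicator A x * f x))"
      by (intro Bochner_Integration.integrable_diff g_int[OF f'])
    then show "integrable ?T (\<lambda>x. indicator A x * (h0 x $ i * f x))"
      by (simp add: h0_nth algebra_simps)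
  qed
  have comp: "\<mu> A $ i = (\<integral>x. indicator A x * h0 x $ i \<partial>?T)" if A: "A \<in> sets borel" for A i
  proof -
    have 1: "set_integrable ?T A (\<lambda>_. 1 :: real)"
      using A by (auto simp: set_integrable_def T.emeasure_eq_measure)
    have "\<mu> A $ i = measure (P i True) A - measure (P i False) A"
      using jordan_decomposition[OF vector_measure_component[OF \<mu>] A, of i] by (simp add: P_def)
    also have "\<dots> = signed_set_integral (\<lambda>B. \<mu> B $ i) A (\<lambda>_. 1)"
      using A by (simp add: signed_set_integral_def set_lebesgue_integral_def P_def)
    also have "\<dots> = (\<integral>x. indicator A x * h0 x $ i \<partial>?T)"
      using signed(1)[OF A 1] by simp
    finally show ?thesis .
  qed
  have h0A: "integrable ?T (\<lambda>x. indicator A x *\<^sub>R h0 x)" if "A \<in> sets borel" for A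
    using that by (intro integrable_mult_indicator h0_int) simp
  have mu_eq: "\<mu> A = (\<integral>x. indicator A x *\<^sub>R h0 x \<partial>?T)" if A: "A \<in> sets borel" for A
    using comp[OF A] integral_bounded_linear[OF bounded_linear_vec_nth h0A[OF A]]
    by (simp add: vec_eq_iff)
  have AE1: "AE x in ?T. norm (h0 x) \<le> 1"
  proof (rule norm_le_1_of_integral_le[OF T.finite_measure_axioms h0_int])
    fix A assume "A \<in> sets ?T"
    then show "norm (\<integral>x. indicator A x *\<^sub>R h0 x \<partial>?T) \<le> measure ?T A"
      using norm_le_total_variation[OF \<mu>, of A] mu_eq[of A] by (simp add: T.emeasure_eq_measure)
  qed
  define h where "h x = (if norm (h0 x) \<le> 1 then h0 x else 0)" for x
  have h0_meas[measurable]: "h0 \<in> borel_measurable borel"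
    using h0_int by (simp add: measurable_cong_sets[OF sets_total_variation refl] integrable_iff_bounded)
  have h_meas[measurable]: "h \<in> borel_measurable borel"
    unfolding h_def by measurable
  have AEh: "AE x in ?T. h0 x = h x"
    using AE1 by eventually_elim (simp add: h_def)
  have "\<mu> A = (LINT x:A|?T. h x)" if A: "A \<in> sets borel" for A
    unfolding mu_eq[OF A] set_lebesgue_integral_def
    using AEh A by (intro integral_cong_AE) auto
  moreover have "inner_integral_on \<mu> A u = (LINT x:A|?T. u x \<bullet> h x)"
    if A: "A \<in> sets borel" and u: "set_integrable ?T A u" for A u
  proof -
    have ui: "set_integrable ?T A (\<lambda>x. u x $ i)" for i
      using integrable_bounded_linear[OF bounded_linear_vec_nth u[unfolded set_integrable_def]]
      by (simp add: set_integrable_def)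
    have "inner_integral_on \<mu> A u = (\<Sum>i\<in>UNIV. \<integral>x. indicator A x * (h0 x $ i * u x $ i) \<partial>?T)"
      unfolding inner_integral_on_def by (intro sum.cong refl signed A ui)
    also have "\<dots> = (\<integral>x. (\<Sum>i\<in>UNIV. indicator A x * (h0 x $ i * u x $ i)) \<partial>?T)"
      by (rule Bochner_Integration.integral_sum[symmetric]) (rule signed(2)[OF A ui])
    also have "\<dots> = (LINT x:A|?T. u x \<bullet> h0 x)"
      unfolding set_lebesgue_integral_def
      by (simp add: inner_vec_def sum_distrib_left mult.commute)
    also have "\<dots> = (LINT x:A|?T. u x \<bullet> h x)"
      unfolding set_lebesgue_integral_def
    proof (rule integral_cong_AE)
      have [measurable]: "(\<lambda>x. indicator A x *\<^sub>R u x) \<in> borel_measurable ?T"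
        using u by (simp add: set_integrable_def)
      have *: "indicator A x *\<^sub>R (u x \<bullet> k x) = (indicator A x *\<^sub>R u x) \<bullet> k x" for k x
        by simp
      show "(\<lambda>x. indicator A x *\<^sub>R (u x \<bullet> h0 x)) \<in> borel_measurable ?T"
        "(\<lambda>x. indicator A x *\<^sub>R (u x \<bullet> h x)) \<in> borel_measurable ?T"
        unfolding * by measurable
    qed (use AEh in auto)
    finally show ?thesis .
  qed
  moreover have "norm (h x) \<le> 1" for x
    by (simp add: h_def)
  ultimately have "polar_density \<mu> h"
    using h_meas by (auto simp: polar_density_def)
  then show thesis ..
qed


section \<open>Weak duality\<close>

lemma measurable_fst_borel [measurable]: "fst \<in> borel_measurable borel"
  by (intro borel_measurable_continuous_onI continuous_intros)

lemma measurable_snd_borel [measurable]: "snd \<in> borel_measurable borel"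
  by (intro borel_measurable_continuous_onI continuous_intros)

lemma measurable_dist_pair [measurable]:
  "(\<lambda>p :: 'a::metric_space \<times> 'a. dist (fst p) (snd p)) \<in> borel_measurable borel"
  by (intro borel_measurable_continuous_onI continuous_intros)

lemma polar_densityD:
  assumes "polar_density \<mu> h"
  shows "h \<in> borel_measurable borel" "norm (h x) \<le> 1"
    "A \<in> sets borel \<Longrightarrow> (\<integral>x. indicator A x *\<^sub>R h x \<partial>total_variation \<mu>) = \<mu> A"
    "A \<in> sets borel \<Longrightarrow> set_integrable (total_variation \<mu>) A u \<Longrightarrow>
       inner_integral_on \<mu> A u = (LINT x:A|total_variation \<mu>. u x \<bullet> h x)"
  using assms by (auto simp: polar_density_def set_lebesgue_integral_def)

lemma integrable_scaleR_polar:
  fixes \<mu> :: "'a::topological_space set \<Rightarrow> real ^ 'm"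
  assumes h: "polar_density \<mu> h" and f: "integrable (total_variation \<mu>) (f :: 'a \<Rightarrow> real)"
  shows "integrable (total_variation \<mu>) (\<lambda>x. f x *\<^sub>R h x)"
proof (rule Bochner_Integration.integrable_bound[OF f])
  have [measurable]: "h \<in> borel_measurable borel" "f \<in> borel_measurable (total_variation \<mu>)"
    using polar_densityD(1)[OF h] f by auto
  show "(\<lambda>x. f x *\<^sub>R h x) \<in> borel_measurable (total_variation \<mu>)"
    by measurable
  show "AE x in total_variation \<mu>. norm (f x *\<^sub>R h x) \<le> norm (f x)"
    using polar_densityD(2)[OF h] by (intro AE_I2) (simp add: mult_left_le)
qed

lemma integrable_inner_polar:
  fixes \<mu> :: "'a::topological_space set \<Rightarrow> real ^ 'm"
  assumes h: "polar_density \<mu> h" and f: "integrable (total_variation \<mu>) u"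
  shows "integrable (total_variation \<mu>) (\<lambda>x. u x \<bullet> h x)"
proof (rule Bochner_Integration.integrable_bound[OF integrable_norm[OF f]])
  have [measurable]: "h \<in> borel_measurable borel" "u \<in> borel_measurable (total_variation \<mu>)"
    using polar_densityD(1)[OF h] f by auto
  show "(\<lambda>x. u x \<bullet> h x) \<in> borel_measurable (total_variation \<mu>)"
    by measurable
  have "\<bar>u x \<bullet> h x\<bar> \<le> norm (u x)" for x
    using Cauchy_Schwarz_ineq2[of "u x" "h x"] mult_left_le[OF polar_densityD(2)[OF h, of x] norm_ge_zero[of "u x"]]
    by linarith
  then show "AE x in total_variation \<mu>. norm (u x \<bullet> h x) \<le> norm (norm (u x))"
    by (intro AE_I2) simp
qed

text \<open>
  For indicators this is the defining property of a transport; it extends to nonnegative bounded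
  functions by linearity and monotone limits, and to bounded functions by adding a constant.
\<close>

lemma integral_marginals_bounded:
  fixes \<mu> :: "'a::{metric_space, second_countable_topology} set \<Rightarrow> real ^ 'm" and f :: "'a \<Rightarrow> real"
  assumes \<mu>: "vector_measure \<mu>" and \<pi>: "\<pi> \<in> transports \<mu>"
    and h: "polar_density \<mu> h" and k: "polar_density \<pi> k"
    and f: "f \<in> borel_measurable borel" "\<And>x. \<bar>f x\<bar> \<le> C"
  shows "(\<integral>x. f x *\<^sub>R h x \<partial>total_variation \<mu>)
       = (\<integral>p. (f (fst p) - f (snd p)) *\<^sub>R k p \<partial>total_variation \<pi>)"
proof -
  have v\<pi>: "vector_measure \<pi>"
    and marg: "\<And>A. A \<in> sets borel \<Longrightarrow> \<pi> (A \<times> UNIV) - \<pi> (UNIV \<times> A) = \<mu> A"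
    using \<pi> by (auto simp: transports_def marginal1_def marginal2_def)
  let ?T = "total_variation \<mu>" and ?S = "total_variation \<pi>"
  interpret T: finite_measure ?T by (rule finite_measure_total_variation[OF \<mu>])
  interpret S: finite_measure ?S by (rule finite_measure_total_variation[OF v\<pi>])
  have [measurable]: "h \<in> borel_measurable borel" "k \<in> borel_measurable borel"
    using polar_densityD(1)[OF h] polar_densityD(1)[OF k] .
  let ?D = "\<lambda>g p. g (fst p) - g (snd p)"
  have int: "integrable ?T (\<lambda>x. g x *\<^sub>R h x)" "integrable ?S (\<lambda>p. g (fst p) *\<^sub>R k p)"
      "integrable ?S (\<lambda>p. g (snd p) *\<^sub>R k p)"
    if g[measurable]: "g \<in> borel_measurable borel" and b: "\<And>x. \<bar>g x\<bar> \<le> B" for g :: "'a \<Rightarrow> real" and B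
  proof -
    show "integrable ?T (\<lambda>x. g x *\<^sub>R h x)"
      using b by (intro integrable_scaleR_polar[OF h] T.integrable_const_bound[of _ B] AE_I2) auto
    show "integrable ?S (\<lambda>p. g (fst p) *\<^sub>R k p)" "integrable ?S (\<lambda>p. g (snd p) *\<^sub>R k p)"
      using b by (intro integrable_scaleR_polar[OF k] S.integrable_const_bound[of _ B] AE_I2; simp)+
  qed
  have main: "(\<exists>B. \<forall>x. g x \<le> B) \<longrightarrow> (\<integral>x. g x *\<^sub>R h x \<partial>?T) = (\<integral>p. ?D g p *\<^sub>R k p \<partial>?S)"
    if "g \<in> borel_measurable borel" "\<And>x. 0 \<le> g x" for g :: "'a \<Rightarrow> real"
    using that
  proof (induction rule: borel_measurable_induct_real)
    case (set A)
    have [measurable]: "A \<in> sets borel" by fact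
    have m: "A \<times> UNIV \<in> sets borel" "UNIV \<times> A \<in> sets borel"
      using set by (auto intro!: borel_Times)
    have e: "indicator A (fst p) = (indicator (A \<times> UNIV) p :: real)"
      "indicator A (snd p) = (indicator (UNIV \<times> A) p :: real)" for p :: "'a \<times> 'a"
      by (auto simp: indicator_def mem_Times_iff)
    have "(\<integral>p. ?D (indicator A) p *\<^sub>R k p \<partial>?S)
        = (\<integral>p. indicator A (fst p) *\<^sub>R k p \<partial>?S) - (\<integral>p. indicator A (snd p) *\<^sub>R k p \<partial>?S)"
      unfolding scaleR_diff_left
      by (rule Bochner_Integration.integral_diff; rule int[of _ 1]) (auto simp: indicator_def)
    also have "\<dots> = \<mu> A"
      unfolding e by (simp only: polar_densityD(3)[OF k] m marg[OF set])
    finally show ?case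
      using polar_densityD(3)[OF h set] by simp
  next
    case (mult u c)
    show ?case
    proof (cases "c = 0")
      case False
      with mult have c: "0 < c" by simp
      show ?thesis
      proof
        assume "\<exists>B. \<forall>x. c * u x \<le> B"
        then obtain B where "\<And>x. c * u x \<le> B" by blast
        then have "\<And>x. u x \<le> B / c"
          using c by (simp add: field_simps)
        then have "(\<integral>x. u x *\<^sub>R h x \<partial>?T) = (\<integral>p. ?D u p *\<^sub>R k p \<partial>?S)"
          using mult.IH by blast
        then have "(\<integral>x. c *\<^sub>R (u x *\<^sub>R h x) \<partial>?T) = (\<integral>p. c *\<^sub>R (?D u p *\<^sub>R k p) \<partial>?S)"
          by (simp only: integral_scaleR_right)
        then show "(\<integral>x. (c * u x) *\<^sub>R h x \<partial>?T) = (\<integral>p. (c * u (fst p) - c * u (snd p)) *\<^sub>R k p \<partial>?S)"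
          by (simp add: right_diff_distrib)
      qed
    qed simp
  next
    case (add u v)
    show ?case
    proof
      assume "\<exists>B. \<forall>x. v x + u x \<le> B"
      then obtain B where B: "\<And>x. v x + u x \<le> B" by blast
      have b: "u x \<le> B" "v x \<le> B" for x
        using B[of x] add.hyps(2,4)[of x] by linarith+
      have ab: "\<bar>u x\<bar> \<le> B" "\<bar>v x\<bar> \<le> B" for x
        using b[of x] add.hyps(2,4)[of x] by linarith+
      have eq: "(\<integral>x. u x *\<^sub>R h x \<partial>?T) = (\<integral>p. ?D u p *\<^sub>R k p \<partial>?S)"
        "(\<integral>x. v x *\<^sub>R h x \<partial>?T) = (\<integral>p. ?D v p *\<^sub>R k p \<partial>?S)"
        using add.IH b by blast+
      note iu = int[OF add.hyps(1) ab(1)] and iv = int[OF add.hyps(3) ab(2)]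
      have D: "integrable ?S (\<lambda>p. ?D u p *\<^sub>R k p)" "integrable ?S (\<lambda>p. ?D v p *\<^sub>R k p)"
        unfolding scaleR_diff_left using iu iv by auto
      have "(\<integral>x. (v x + u x) *\<^sub>R h x \<partial>?T) = (\<integral>x. v x *\<^sub>R h x \<partial>?T) + (\<integral>x. u x *\<^sub>R h x \<partial>?T)"
        unfolding scaleR_add_left by (rule Bochner_Integration.integral_add[OF iv(1) iu(1)])
      also have "\<dots> = (\<integral>p. ?D v p *\<^sub>R k p + ?D u p *\<^sub>R k p \<partial>?S)"
        unfolding eq by (rule Bochner_Integration.integral_add[OF D(2,1), symmetric])
      finally show "(\<integral>x. (v x + u x) *\<^sub>R h x \<partial>?T)
          = (\<integral>p. (v (fst p) + u (fst p) - (v (snd p) + u (snd p))) *\<^sub>R k p \<partial>?S)"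
        by (simp add: algebra_simps)
    qed
  next
    case (seq U)
    have [measurable]: "U i \<in> borel_measurable borel" for i by (rule seq.hyps)
    have lim: "(\<lambda>i. U i x) \<longlonglongrightarrow> g x" for x
      using seq.hyps(4) by simp
    show ?case
    proof
      assume "\<exists>B. \<forall>x. g x \<le> B"
      then obtain B where B: "\<And>x. g x \<le> B" by blast
      have Ug: "U i x \<le> g x" for i x
        using seq.hyps(3) lim[of x] by (intro incseq_le) (auto simp: incseq_def le_fun_def)
      have UB: "\<bar>U i x\<bar> \<le> B" for i x
        using Ug[of i x] B[of x] seq.hyps(2)[of i x] by linarith
      have [measurable]: "g \<in> borel_measurable borel"
        using lim by (rule borel_measurable_LIMSEQ_real) measurable
      have eq: "(\<integral>x. U i x *\<^sub>R h x \<partial>?T) = (\<integral>p. ?D (U i) p *\<^sub>R k p \<partial>?S)" for i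
        using seq.IH[of i] Ug B by (meson order_trans)
      have "(\<lambda>i. \<integral>x. U i x *\<^sub>R h x \<partial>?T) \<longlonglongrightarrow> (\<integral>x. g x *\<^sub>R h x \<partial>?T)"
      proof (rule integral_dominated_convergence[where w = "\<lambda>_. B"])
        have "norm (U i x *\<^sub>R h x) \<le> B" for i x
          using mult_mono[OF UB[of i x] polar_densityD(2)[OF h, of x]] UB[of i x] by simp
        then show "AE x in ?T. norm (U i x *\<^sub>R h x) \<le> B" for i
          by simp
      qed (auto intro!: tendsto_intros lim)
      moreover have "(\<lambda>i. \<integral>p. ?D (U i) p *\<^sub>R k p \<partial>?S) \<longlonglongrightarrow> (\<integral>p. ?D g p *\<^sub>R k p \<partial>?S)"
      proof (rule integral_dominated_convergence[where w = "\<lambda>_. 2 * B"])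
        have "norm (?D (U i) p *\<^sub>R k p) \<le> 2 * B" for i p
        proof -
          have "\<bar>?D (U i) p\<bar> \<le> 2 * B"
            using UB[of i "fst p"] UB[of i "snd p"] by linarith
          then show ?thesis
            using mult_mono[OF _ polar_densityD(2)[OF k, of p], of "\<bar>?D (U i) p\<bar>" "2 * B"] by simp
        qed
        then show "AE p in ?S. norm (?D (U i) p *\<^sub>R k p) \<le> 2 * B" for i
          by simp
      qed (auto intro!: tendsto_intros lim)
      ultimately show "(\<integral>x. g x *\<^sub>R h x \<partial>?T) = (\<integral>p. ?D g p *\<^sub>R k p \<partial>?S)"
        unfolding eq by (rule LIMSEQ_unique)
    qed
  qed
  have [measurable]: "f \<in> borel_measurable borel" by (rule f)
  have fC: "0 \<le> f x + C" "f x + C \<le> 2 * C" for x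
    using f(2)[of x] by linarith+
  have "0 \<le> C" using f(2)[of undefined] by linarith
  have "(\<integral>x. (f x + C) *\<^sub>R h x \<partial>?T) = (\<integral>p. ?D f p *\<^sub>R k p \<partial>?S)"
    using main[of "\<lambda>x. f x + C"] fC exI[of "\<lambda>B. \<forall>x. f x + C \<le> B" "2 * C"] by simp
  moreover have "(\<integral>x. C *\<^sub>R h x \<partial>?T) = 0"
    using main[of "\<lambda>x. C"] \<open>0 \<le> C\<close> by auto
  moreover have "(\<integral>x. (f x + C) *\<^sub>R h x \<partial>?T) = (\<integral>x. f x *\<^sub>R h x \<partial>?T) + (\<integral>x. C *\<^sub>R h x \<partial>?T)"
    unfolding scaleR_add_left using \<open>0 \<le> C\<close>
    by (intro Bochner_Integration.integral_add int[OF f] int[of _ C]) auto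
  ultimately show ?thesis
    by (simp only: add_0_right)
qed

text \<open>
  The marginals of a transport may fail to have a first moment even when its cost is finite, so
  \<open>f (fst p)\<close> and \<open>f (snd p)\<close> need not be integrable separately. Truncating \<open>f\<close> at height \<open>n\<close>
  reduces to bounded functions, and truncation does not increase \<open>\<bar>f (fst p) - f (snd p)\<bar>\<close>, which
  therefore dominates in the passage to the limit.
\<close>

lemma integral_marginals:
  fixes \<mu> :: "'a::{metric_space, second_countable_topology} set \<Rightarrow> real ^ 'm" and f :: "'a \<Rightarrow> real"
  assumes \<mu>: "vector_measure \<mu>" and \<pi>: "\<pi> \<in> transports \<mu>"
    and h: "polar_density \<mu> h" and k: "polar_density \<pi> k"
    and f[measurable]: "f \<in> borel_measurable borel" and int1: "integrable (total_variation \<mu>) f"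
    and int2: "integrable (total_variation \<pi>) (\<lambda>p. f (fst p) - f (snd p))"
  shows "(\<integral>x. f x *\<^sub>R h x \<partial>total_variation \<mu>)
       = (\<integral>p. (f (fst p) - f (snd p)) *\<^sub>R k p \<partial>total_variation \<pi>)"
proof -
  let ?T = "total_variation \<mu>" and ?S = "total_variation \<pi>"
  define F where "F n x = max (- real n) (min (real n) (f x))" for n x
  have F_meas [measurable]: "F n \<in> borel_measurable borel" for n
    unfolding F_def by measurable
  have [measurable]: "h \<in> borel_measurable borel" "k \<in> borel_measurable borel"
    using polar_densityD(1)[OF h] polar_densityD(1)[OF k] .
  have lim: "(\<lambda>n. F n x) \<longlonglongrightarrow> f x" for x
  proof (rule tendsto_eventually)
    obtain N where N: "\<bar>f x\<bar> \<le> real N" using real_arch_simple by blast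
    show "\<forall>\<^sub>F n in sequentially. F n x = f x"
      using eventually_ge_at_top[of N]
    proof eventually_elim
      case (elim n)
      then have "real N \<le> real n" by simp
      with N show ?case by (simp add: F_def)
    qed
  qed
  have eq: "(\<integral>x. F n x *\<^sub>R h x \<partial>?T) = (\<integral>p. (F n (fst p) - F n (snd p)) *\<^sub>R k p \<partial>?S)" for n
    by (rule integral_marginals_bounded[OF \<mu> \<pi> h k F_meas, where C = "real n"]) (auto simp: F_def)
  have small: "norm (a *\<^sub>R b) \<le> c" if "\<bar>a\<bar> \<le> c" "norm b \<le> 1" for a c and b :: "real ^ 'm"
    using mult_mono[OF that] that by simp
  have "(\<lambda>n. \<integral>x. F n x *\<^sub>R h x \<partial>?T) \<longlonglongrightarrow> (\<integral>x. f x *\<^sub>R h x \<partial>?T)"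
  proof (rule integral_dominated_convergence[where w = "\<lambda>x. \<bar>f x\<bar>"])
    show "AE x in ?T. norm (F n x *\<^sub>R h x) \<le> \<bar>f x\<bar>" for n
      by (intro AE_I2 small polar_densityD(2)[OF h]) (auto simp: F_def)
  qed (use int1 in \<open>auto intro!: tendsto_intros lim\<close>)
  moreover have "(\<lambda>n. \<integral>p. (F n (fst p) - F n (snd p)) *\<^sub>R k p \<partial>?S)
      \<longlonglongrightarrow> (\<integral>p. (f (fst p) - f (snd p)) *\<^sub>R k p \<partial>?S)"
  proof (rule integral_dominated_convergence[where w = "\<lambda>p. \<bar>f (fst p) - f (snd p)\<bar>"])
    show "AE p in ?S. norm ((F n (fst p) - F n (snd p)) *\<^sub>R k p) \<le> \<bar>f (fst p) - f (snd p)\<bar>" for n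
      by (intro AE_I2 small polar_densityD(2)[OF k]) (auto simp: F_def)
  qed (use int2 in \<open>auto intro!: tendsto_intros lim\<close>)
  ultimately show ?thesis
    unfolding eq by (rule LIMSEQ_unique)
qed

lemma transport_cost_on_eq:
  "transport_cost_on \<pi> A = (\<integral>\<^sup>+p. ennreal (dist (fst p) (snd p)) * indicator A p \<partial>total_variation \<pi>)"
  by (simp add: transport_cost_on_def case_prod_beta')

lemma integrable_dist_transport:
  assumes "transport_cost \<pi> < \<infinity>"
  shows "integrable (total_variation \<pi>) (\<lambda>p. dist (fst p) (snd p))"
  using assms by (simp add: integrable_iff_bounded transport_cost_on_eq)

lemma transport_cost_on_eq_integral:
  assumes fin: "transport_cost \<pi> < \<infinity>" and A: "A \<in> sets borel"
  shows "transport_cost_on \<pi> A = ennreal (LINT p:A|total_variation \<pi>. dist (fst p) (snd p))"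
proof -
  have "integrable (total_variation \<pi>) (\<lambda>p. indicator A p *\<^sub>R dist (fst p) (snd p))"
    using A by (intro integrable_mult_indicator integrable_dist_transport[OF fin]) auto
  then show ?thesis
    unfolding transport_cost_on_eq set_lebesgue_integral_def
    by (subst nn_integral_eq_integral[symmetric])
       (auto intro!: nn_integral_cong simp: indicator_def)
qed

lemma lipschitz_1_norm_le:
  "1-lipschitz_on UNIV u \<Longrightarrow> norm (u x - u y) \<le> dist x y"
  by (metis dist_norm lipschitz_onD mult_1 UNIV_I)

lemma measurable_lipschitz:
  "L-lipschitz_on UNIV u \<Longrightarrow> u \<in> borel_measurable borel"
  by (intro borel_measurable_continuous_onI lipschitz_on_continuous_on)

lemma integrable_lipschitz_wasserstein:
  fixes \<mu> :: "'a::{metric_space, second_countable_topology} set \<Rightarrow> real ^ 'm"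
  assumes \<mu>: "\<mu> \<in> wasserstein_space" and u: "1-lipschitz_on UNIV (u :: 'a \<Rightarrow> real ^ 'm)"
  shows "integrable (total_variation \<mu>) u"
proof -
  obtain x0 where v: "vector_measure \<mu>"
    and fin: "(\<integral>\<^sup>+x. ennreal (dist x x0) \<partial>total_variation \<mu>) < \<infinity>"
    using \<mu> by (auto simp: wasserstein_space_def)
  interpret T: finite_measure "total_variation \<mu>"
    by (rule finite_measure_total_variation[OF v])
  have [measurable]: "u \<in> borel_measurable borel"
    by (rule measurable_lipschitz[OF u])
  have "integrable (total_variation \<mu>) (\<lambda>x. dist x x0)"
    using fin by (simp add: integrable_iff_bounded)
  then have "integrable (total_variation \<mu>) (\<lambda>x. norm (u x0) + dist x x0)"
    by simp
  then show ?thesis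
  proof (rule Bochner_Integration.integrable_bound)
    have "norm (u x) \<le> norm (u x0) + dist x x0" for x
      using lipschitz_1_norm_le[OF u, of x x0] norm_triangle_sub[of "u x" "u x0"] by linarith
    then show "AE x in total_variation \<mu>. norm (u x) \<le> norm (norm (u x0) + dist x x0)"
      by (intro AE_I2) (smt (verit) real_norm_def)
  qed measurable
qed

lemma integrable_lipschitz_diff_transport:
  fixes u :: "'a::{metric_space, second_countable_topology} \<Rightarrow> real ^ 'm"
  assumes fin: "transport_cost \<pi> < \<infinity>" and u: "1-lipschitz_on UNIV u"
  shows "integrable (total_variation \<pi>) (\<lambda>p. u (fst p) - u (snd p))"
proof (rule Bochner_Integration.integrable_bound[OF integrable_dist_transport[OF fin]])
  have [measurable]: "u \<in> borel_measurable borel"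
    by (rule measurable_lipschitz[OF u])
  show "(\<lambda>p. u (fst p) - u (snd p)) \<in> borel_measurable (total_variation \<pi>)"
    by measurable
qed (use lipschitz_1_norm_le[OF u] in auto)

lemma inner_integral_transport:
  fixes \<mu> :: "'a::{metric_space, second_countable_topology} set \<Rightarrow> real ^ 'm"
  assumes \<mu>: "\<mu> \<in> wasserstein_space" and \<pi>: "\<pi> \<in> transports \<mu>"
    and fin: "transport_cost \<pi> < \<infinity>" and u: "1-lipschitz_on UNIV u"
  shows "inner_integral \<mu> u = inner_integral_on \<pi> UNIV (\<lambda>(x, y). u x - u y)"
proof -
  let ?T = "total_variation \<mu>" and ?S = "total_variation \<pi>"
  let ?D = "\<lambda>p. u (fst p) - u (snd p)"
  have v: "vector_measure \<mu>" "vector_measure \<pi>"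
    using \<mu> \<pi> by (auto simp: wasserstein_space_def transports_def)
  obtain h where h: "polar_density \<mu> h" using polar_density_exists[OF v(1)] .
  obtain k where k: "polar_density \<pi> k" using polar_density_exists[OF v(2)] .
  have u_meas [measurable]: "u \<in> borel_measurable borel"
    by (rule measurable_lipschitz[OF u])
  note iu = integrable_lipschitz_wasserstein[OF \<mu> u]
  note iD = integrable_lipschitz_diff_transport[OF fin u]
  have nth: "integrable ?T (\<lambda>x. u x $ i)" "integrable ?S (\<lambda>p. u (fst p) $ i - u (snd p) $ i)" for i
    using integrable_bounded_linear[OF bounded_linear_vec_nth iu, of i]
      integrable_bounded_linear[OF bounded_linear_vec_nth iD, of i] by simp_all
  have nthh: "integrable ?T (\<lambda>x. u x $ i *\<^sub>R h x)" "integrable ?S (\<lambda>p. (u (fst p) $ i - u (snd p) $ i) *\<^sub>R k p)" for i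
    by (rule integrable_scaleR_polar[OF h nth(1)], rule integrable_scaleR_polar[OF k nth(2)])
  have eq: "(\<integral>x. u x $ i *\<^sub>R h x \<partial>?T) = (\<integral>p. (u (fst p) $ i - u (snd p) $ i) *\<^sub>R k p \<partial>?S)" for i
    by (rule integral_marginals[OF v(1) \<pi> h k _ nth])
       (rule measurable_compose[OF u_meas borel_measurable_continuous_onI],
        intro continuous_intros)
  have "(\<integral>x. u x $ i * h x $ i \<partial>?T) = (\<integral>p. (u (fst p) $ i - u (snd p) $ i) * k p $ i \<partial>?S)" for i
    using arg_cong[OF eq[of i], of "\<lambda>z. z $ i"]
      integral_bounded_linear[OF bounded_linear_vec_nth nthh(1), of i i]
      integral_bounded_linear[OF bounded_linear_vec_nth nthh(2), of i i] by simp
  moreover have "integrable ?T (\<lambda>x. u x $ i * h x $ i)"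
      "integrable ?S (\<lambda>p. (u (fst p) $ i - u (snd p) $ i) * k p $ i)" for i
    using integrable_bounded_linear[OF bounded_linear_vec_nth nthh(1), of i i]
      integrable_bounded_linear[OF bounded_linear_vec_nth nthh(2), of i i] by simp_all
  ultimately have "(\<integral>x. u x \<bullet> h x \<partial>?T) = (\<integral>p. ?D p \<bullet> k p \<partial>?S)"
    by (simp add: inner_vec_def Bochner_Integration.integral_sum)
  moreover have "inner_integral \<mu> u = (\<integral>x. u x \<bullet> h x \<partial>?T)"
    using polar_densityD(4)[OF h, of UNIV u] iu by (simp add: set_integrable_def set_lebesgue_integral_def)
  moreover have "inner_integral_on \<pi> UNIV ?D = (\<integral>p. ?D p \<bullet> k p \<partial>?S)"
    using polar_densityD(4)[OF k, of UNIV ?D] iD by (simp add: set_integrable_def set_lebesgue_integral_def)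
  ultimately show ?thesis
    by (simp add: case_prod_beta')
qed

text \<open>
  The defect \<open>g = d - \<langle>\<Delta>u, k\<rangle>\<close>, where \<open>k\<close> is the polar density of \<open>\<pi>\<close> and \<open>\<Delta>u(x, y) = u x - u y\<close>,
  measures the failure of equality in weak duality; it is bounded below by \<open>d - \<parallel>\<Delta>u\<parallel> \<ge> 0\<close>.
\<close>

lemma inner_integral_on_gap:
  fixes \<pi> :: "('a::{metric_space, second_countable_topology} \<times> 'a) set \<Rightarrow> real ^ 'm"
  assumes \<pi>: "vector_measure \<pi>" and fin: "transport_cost \<pi> < \<infinity>" and u: "1-lipschitz_on UNIV u"
  obtains g where "integrable (total_variation \<pi>) g" "\<And>p. dist (fst p) (snd p) - norm (u (fst p) - u (snd p)) \<le> g p"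
    "\<And>A. A \<in> sets borel \<Longrightarrow> enn2real (transport_cost_on \<pi> A)
        = inner_integral_on \<pi> A (\<lambda>(x, y). u x - u y) + (LINT p:A|total_variation \<pi>. g p)"
proof -
  let ?S = "total_variation \<pi>" and ?D = "\<lambda>p. u (fst p) - u (snd p)"
  obtain k where k: "polar_density \<pi> k" using polar_density_exists[OF \<pi>] .
  define g where "g p = dist (fst p) (snd p) - ?D p \<bullet> k p" for p
  note iD = integrable_lipschitz_diff_transport[OF fin u]
  note id = integrable_dist_transport[OF fin]
  note ik = integrable_inner_polar[OF k iD]
  have "integrable ?S g"
    unfolding g_def using id ik by (rule Bochner_Integration.integrable_diff)
  moreover have "dist (fst p) (snd p) - norm (?D p) \<le> g p" for p
  proof -
    have "?D p \<bullet> k p \<le> norm (?D p) * norm (k p)" by (rule norm_cauchy_schwarz)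
    also have "\<dots> \<le> norm (?D p)"
      by (rule mult_left_le[OF polar_densityD(2)[OF k] norm_ge_zero])
    finally show ?thesis by (simp add: g_def)
  qed
  moreover have "enn2real (transport_cost_on \<pi> A)
        = inner_integral_on \<pi> A (\<lambda>(x, y). u x - u y) + (LINT p:A|?S. g p)" if A: "A \<in> sets borel" for A
  proof -
    have A': "A \<in> sets ?S" using A by simp
    have "set_integrable ?S A ?D"
      unfolding set_integrable_def by (rule integrable_mult_indicator[OF A' iD])
    then have "inner_integral_on \<pi> A ?D = (LINT p:A|?S. ?D p \<bullet> k p)"
      by (rule polar_densityD(4)[OF k A])
    moreover have "(LINT p:A|?S. g p) = (LINT p:A|?S. dist (fst p) (snd p)) - (LINT p:A|?S. ?D p \<bullet> k p)"
      unfolding g_def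
      by (rule set_integral_diff(2); unfold set_integrable_def; rule integrable_mult_indicator[OF A']; rule id ik)
    moreover have "enn2real (transport_cost_on \<pi> A) = (LINT p:A|?S. dist (fst p) (snd p))"
      unfolding transport_cost_on_eq_integral[OF fin A]
      by (rule enn2real_ennreal) (auto simp: set_lebesgue_integral_def intro!: Bochner_Integration.integral_nonneg)
    ultimately show ?thesis
      by (simp add: case_prod_beta')
  qed
  ultimately show thesis by (rule that)
qed

text \<open>
  Weak duality: the defect of a finite-cost transport has nonnegative integral, and an infinite cost
  bounds everything.
\<close>

lemma inner_integral_le_transport_cost:
  fixes \<mu> :: "'a::{metric_space, second_countable_topology} set \<Rightarrow> real ^ 'm"
  assumes \<mu>: "\<mu> \<in> wasserstein_space" and \<pi>: "\<pi> \<in> transports \<mu>" and u: "1-lipschitz_on UNIV u"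
  shows "ereal (inner_integral \<mu> u) \<le> enn2ereal (transport_cost \<pi>)"
proof (cases "transport_cost \<pi> < \<infinity>")
  case True
  have v: "vector_measure \<pi>" using \<pi> by (simp add: transports_def)
  obtain g where g: "integrable (total_variation \<pi>) g"
      "\<And>p. dist (fst p) (snd p) - norm (u (fst p) - u (snd p)) \<le> g p"
      "\<And>A. A \<in> sets borel \<Longrightarrow> enn2real (transport_cost_on \<pi> A)
        = inner_integral_on \<pi> A (\<lambda>(x, y). u x - u y) + (LINT p:A|total_variation \<pi>. g p)"
    using inner_integral_on_gap[OF v True u] by blast
  have "0 \<le> g p" for p
    using g(2)[of p] lipschitz_1_norm_le[OF u, of "fst p" "snd p"] by linarith
  then have "0 \<le> (LINT p:UNIV|total_variation \<pi>. g p)"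
    by (simp add: set_lebesgue_integral_def)
  then have "inner_integral \<mu> u \<le> enn2real (transport_cost \<pi>)"
    using g(3)[of UNIV] inner_integral_transport[OF \<mu> \<pi> True u] by simp
  moreover have "enn2ereal (transport_cost \<pi>) = ereal (enn2real (transport_cost \<pi>))"
    using True by (metis enn2ereal_ennreal enn2real_nonneg ennreal_enn2real infinity_ennreal_def)
  ultimately show ?thesis by simp
next
  case False
  then have "transport_cost \<pi> = \<infinity>" by (simp add: less_top[symmetric])
  then show ?thesis by simp
qed

text \<open>
  Equality in weak duality means that the nonnegative defect has integral zero, so it vanishes
  almost everywhere.
\<close>

lemma tight_transport:
  fixes \<pi> :: "('a::{metric_space, second_countable_topology} \<times> 'a) set \<Rightarrow> real ^ 'm"
  assumes \<pi>: "vector_measure \<pi>" and fin: "transport_cost \<pi> < \<infinity>" and u: "1-lipschitz_on UNIV u"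
    and eq: "inner_integral_on \<pi> UNIV (\<lambda>(x, y). u x - u y) = enn2real (transport_cost \<pi>)"
  shows "AE p in total_variation \<pi>. norm (u (fst p) - u (snd p)) = dist (fst p) (snd p)"
    and "A \<in> sets borel \<Longrightarrow>
      inner_integral_on \<pi> A (\<lambda>(x, y). u x - u y) = enn2real (transport_cost_on \<pi> A)"
proof -
  let ?S = "total_variation \<pi>"
  obtain g where g: "integrable ?S g"
      "\<And>p. dist (fst p) (snd p) - norm (u (fst p) - u (snd p)) \<le> g p"
      "\<And>A. A \<in> sets borel \<Longrightarrow> enn2real (transport_cost_on \<pi> A)
        = inner_integral_on \<pi> A (\<lambda>(x, y). u x - u y) + (LINT p:A|?S. g p)"
    using inner_integral_on_gap[OF \<pi> fin u] by blast
  have lip: "norm (u (fst p) - u (snd p)) \<le> dist (fst p) (snd p)" for p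
    by (rule lipschitz_1_norm_le[OF u])
  have nonneg: "0 \<le> g p" for p
    using g(2)[of p] lip[of p] by linarith
  have "integral\<^sup>L ?S g = 0"
    using g(3)[of UNIV] eq by (simp add: set_lebesgue_integral_def)
  then have g0: "AE p in ?S. g p = 0"
    using integral_nonneg_eq_0_iff_AE[OF g(1)] nonneg by auto
  then show "AE p in ?S. norm (u (fst p) - u (snd p)) = dist (fst p) (snd p)"
  proof eventually_elim
    case (elim p)
    with g(2)[of p] lip[of p] show ?case by linarith
  qed
  show "inner_integral_on \<pi> A (\<lambda>(x, y). u x - u y) = enn2real (transport_cost_on \<pi> A)"
    if A: "A \<in> sets borel"
  proof -
    have "(LINT p:A|?S. g p) = 0"
      unfolding set_lebesgue_integral_def
      using g0 by (intro integral_eq_zero_AE) auto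
    then show ?thesis using g(3)[OF A] by simp
  qed
qed


section \<open>Sublinear functionals and the Hahn-Banach theorem\<close>

definition sublinear :: "('v::real_vector \<Rightarrow> real) \<Rightarrow> bool" where
  "sublinear p \<longleftrightarrow> (\<forall>x y. p (x + y) \<le> p x + p y) \<and> (\<forall>c x. 0 \<le> c \<longrightarrow> p (c *\<^sub>R x) = c * p x)"

text \<open>
  An inequality for positive factors suffices for homogeneity, as it can be applied to the inverse
  factor too.
\<close>

lemma sublinearI:
  assumes "\<And>x y. p (x + y) \<le> p x + p y" "p 0 \<le> 0" "\<And>c x. 0 < c \<Longrightarrow> p (c *\<^sub>R x) \<le> c * p x"
  shows "sublinear p"
proof -
  have "0 \<le> p 0" using assms(1)[of 0 0] by simp
  then have p0: "p 0 = 0" using assms(2) by simp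
  have "p (c *\<^sub>R x) = c * p x" if c: "0 \<le> c" for c x
  proof (cases "c = 0")
    case False
    with c have c: "0 < c" by simp
    have "p x \<le> inverse c * p (c *\<^sub>R x)"
      using assms(3)[of "inverse c" "c *\<^sub>R x"] c by simp
    then have "c * p x \<le> p (c *\<^sub>R x)"
      using c by (simp add: field_simps)
    then show ?thesis using assms(3)[OF c, of x] by simp
  qed (simp add: p0)
  then show ?thesis using assms(1) by (simp add: sublinear_def)
qed

lemma sublinear_zero: "sublinear p \<Longrightarrow> p 0 = 0"
  unfolding sublinear_def by (metis mult_zero_left order_refl scaleR_zero_left)

lemma sublinear_minus:
  assumes "sublinear p"
  shows "- p (- x) \<le> p x"
proof -
  have "p (x + - x) \<le> p x + p (- x)"
    using assms by (simp only: sublinear_def)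
  then show ?thesis
    by (simp add: sublinear_zero[OF assms])
qed

text \<open>
  For sublinear \<open>p\<close> this is the largest sublinear functional \<open>q\<close> below \<open>p\<close> with
  \<open>q x \<le> q (x + z) - p z\<close> for all \<open>x\<close>. Its value at \<open>- z\<close> is \<open>- p z\<close>, the least that a sublinear
  functional below \<open>p\<close> can take there.
\<close>

definition regularize_along :: "('v::real_vector \<Rightarrow> real) \<Rightarrow> 'v \<Rightarrow> 'v \<Rightarrow> real" where
  "regularize_along p z x = (INF t\<in>{0..}. p (x + t *\<^sub>R z) - t * p z)"

lemma regularize_along_le:
  assumes p: "sublinear p" and t: "0 \<le> t"
  shows "regularize_along p z x \<le> p (x + t *\<^sub>R z) - t * p z"
proof -
  have "- p (- x) \<le> p (x + s *\<^sub>R z) - s * p z" if "0 \<le> s" for s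
  proof -
    have "p (s *\<^sub>R z) \<le> p (x + s *\<^sub>R z) + p (- x)"
      using p unfolding sublinear_def by (metis add.commute add_minus_cancel)
    then show ?thesis using p that by (simp add: sublinear_def)
  qed
  then have "bdd_below ((\<lambda>t. p (x + t *\<^sub>R z) - t * p z) ` {0..})"
    by (intro bdd_belowI2[of _ "- p (- x)"]) simp
  then show ?thesis
    unfolding regularize_along_def using t by (intro cINF_lower) auto
qed

lemma regularize_along_greatest:
  "(\<And>t. 0 \<le> t \<Longrightarrow> c \<le> p (x + t *\<^sub>R z) - t * p z) \<Longrightarrow> c \<le> regularize_along p z x"
  unfolding regularize_along_def by (intro cINF_greatest) auto

lemma sublinear_regularize_along:
  assumes p: "sublinear p"
  shows "sublinear (regularize_along p z)"
proof (rule sublinearI)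
  let ?q = "regularize_along p z"
  fix x y
  have *: "?q (x + y) \<le> (p (x + s *\<^sub>R z) - s * p z) + (p (y + t *\<^sub>R z) - t * p z)" if "0 \<le> s" "0 \<le> t" for s t
  proof -
    have "?q (x + y) \<le> p (x + y + (s + t) *\<^sub>R z) - (s + t) * p z"
      using that by (intro regularize_along_le[OF p]) simp
    also have "x + y + (s + t) *\<^sub>R z = (x + s *\<^sub>R z) + (y + t *\<^sub>R z)"
      by (simp add: algebra_simps)
    also have "p \<dots> \<le> p (x + s *\<^sub>R z) + p (y + t *\<^sub>R z)"
      using p by (simp add: sublinear_def)
    finally show ?thesis by (simp add: algebra_simps)
  qed
  have "?q (x + y) - (p (x + s *\<^sub>R z) - s * p z) \<le> ?q y" if "0 \<le> s" for s
    using *[OF that] by (intro regularize_along_greatest) (simp add: algebra_simps)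
  then have "?q (x + y) - ?q y \<le> ?q x"
    by (intro regularize_along_greatest) (simp add: algebra_simps)
  then show "?q (x + y) \<le> ?q x + ?q y" by simp
next
  show "regularize_along p z 0 \<le> 0"
    using regularize_along_le[OF p, of 0 z 0] by (simp add: sublinear_zero[OF p])
next
  let ?q = "regularize_along p z"
  fix c :: real and x assume c: "0 < c"
  have "?q (c *\<^sub>R x) / c \<le> ?q x"
  proof (rule regularize_along_greatest)
    fix t :: real assume t: "0 \<le> t"
    have "?q (c *\<^sub>R x) \<le> p (c *\<^sub>R x + (c * t) *\<^sub>R z) - (c * t) * p z"
      using c t by (intro regularize_along_le[OF p]) simp
    also have "c *\<^sub>R x + (c * t) *\<^sub>R z = c *\<^sub>R (x + t *\<^sub>R z)"
      by (simp add: algebra_simps)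
    also have "p \<dots> = c * p (x + t *\<^sub>R z)"
      using p c by (simp add: sublinear_def)
    finally show "?q (c *\<^sub>R x) / c \<le> p (x + t *\<^sub>R z) - t * p z"
      using c by (simp add: field_simps)
  qed
  then show "?q (c *\<^sub>R x) \<le> c * ?q x"
    using c by (simp add: field_simps)
qed

text \<open>
  Zorn's lemma applies because the infimum of a chain of sublinear functionals below \<open>p\<close> is finite,
  being at least \<open>- p (- x)\<close> at \<open>x\<close>, and subadditive, since any two members of the chain are
  comparable.
\<close>

lemma sublinear_minimal_exists:
  fixes p :: "'v::real_vector \<Rightarrow> real"
  assumes p: "sublinear p"
  obtains q where "sublinear q" "q \<le> p" "\<And>r. sublinear r \<Longrightarrow> r \<le> q \<Longrightarrow> r = q"
proof -
  let ?A = "{q. sublinear q \<and> q \<le> p}"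
  let ?P = "\<lambda>q r. r \<le> (q :: 'v \<Rightarrow> real)"
  have "\<exists>m\<in>?A. \<forall>a\<in>?A. ?P m a \<longrightarrow> a = m"
  proof (rule predicate_Zorn)
    show "partial_order_on ?A (relation_of ?P ?A)"
      by (rule partial_order_on_relation_ofI) auto
  next
    fix C assume C: "C \<in> Chains (relation_of ?P ?A)"
    then have CA: "q \<in> C \<Longrightarrow> sublinear q" "q \<in> C \<Longrightarrow> q \<le> p" for q
      unfolding Chains_def relation_of_def by auto
    have chain: "q \<le> r \<or> r \<le> q" if "q \<in> C" "r \<in> C" for q r
      using C that unfolding Chains_def relation_of_def by auto
    show "\<exists>u\<in>?A. \<forall>q\<in>C. ?P q u"
    proof (cases "C = {}")
      case True
      then show ?thesis using p by auto
    next
      case False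
      define u where "u x = (INF q\<in>C. q x)" for x
      have low: "u x \<le> q x" if "q \<in> C" for q x
      proof -
        have "- p (- x) \<le> r x" if "r \<in> C" for r
          using sublinear_minus[OF CA(1)[OF that], of x] CA(2)[OF that] by (meson le_funD neg_le_iff_le order_trans)
        then have "bdd_below ((\<lambda>q. q x) ` C)"
          by (intro bdd_belowI2[of _ "- p (- x)"]) simp
        then show ?thesis unfolding u_def using that by (intro cINF_lower)
      qed
      have great: "c \<le> u x" if "\<And>q. q \<in> C \<Longrightarrow> c \<le> q x" for c x
        unfolding u_def using False that by (intro cINF_greatest)
      have "sublinear u"
      proof (rule sublinearI)
        fix x y
        have *: "u (x + y) \<le> q x + r y" if qr: "q \<in> C" "r \<in> C" for q r
        proof -
          obtain s where s: "s \<in> C" "s \<le> q" "s \<le> r"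
            using chain[OF qr] qr by blast
          have "u (x + y) \<le> s (x + y)" by (rule low[OF s(1)])
          also have "\<dots> \<le> s x + s y" using CA(1)[OF s(1)] by (simp add: sublinear_def)
          also have "\<dots> \<le> q x + r y" using s by (intro add_mono) (auto simp: le_fun_def)
          finally show ?thesis .
        qed
        have "u (x + y) - q x \<le> u y" if "q \<in> C" for q
          using *[OF that] by (intro great) (simp add: algebra_simps)
        then have "u (x + y) - u y \<le> u x"
          by (intro great) (simp add: algebra_simps)
        then show "u (x + y) \<le> u x + u y" by simp
      next
        obtain q where q: "q \<in> C" using False by blast
        show "u 0 \<le> 0"
          using low[OF q, of 0] sublinear_zero[OF CA(1)[OF q]] by simp
      next
        fix c :: real and x assume c: "0 < c"
        have "u (c *\<^sub>R x) / c \<le> u x"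
        proof (rule great)
          fix q assume q: "q \<in> C"
          have "u (c *\<^sub>R x) \<le> c * q x"
            using low[OF q, of "c *\<^sub>R x"] CA(1)[OF q] c by (simp add: sublinear_def)
          then show "u (c *\<^sub>R x) / c \<le> q x"
            using c by (simp add: field_simps)
        qed
        then show "u (c *\<^sub>R x) \<le> c * u x"
          using c by (simp add: field_simps)
      qed
      moreover have "u \<le> p"
        using False low CA(2) by (meson all_not_in_conv le_fun_def order_trans)
      ultimately show ?thesis
        using low by (auto simp: le_fun_def)
    qed
  qed
  then show thesis using that by (metis (mono_tags, lifting) mem_Collect_eq order_trans)
qed

text \<open>
  Regularizing a minimal sublinear functional \<open>q\<close> along \<open>y\<close> does not change it, which says
  \<open>q x \<le> q (x + y) - q y\<close>; subadditivity gives the reverse inequality.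
\<close>

lemma sublinear_minimal_imp_linear:
  assumes q: "sublinear q" and min: "\<And>r. sublinear r \<Longrightarrow> r \<le> q \<Longrightarrow> r = q"
  shows "linear q"
proof -
  have add: "q (x + y) = q x + q y" for x y
  proof -
    have "regularize_along q y \<le> q"
      using regularize_along_le[OF q, of 0 y] by (simp add: le_fun_def)
    then have "regularize_along q y = q"
      by (intro min sublinear_regularize_along[OF q])
    then have "q x \<le> q (x + y) - q y"
      using regularize_along_le[OF q, of 1 y x] by simp
    then show ?thesis
      using q unfolding sublinear_def by (smt (verit))
  qed
  have neg: "q (- x) = - q x" for x
    using add[of x "- x"] sublinear_zero[OF q] by simp
  have hom: "0 \<le> c \<Longrightarrow> q (c *\<^sub>R x) = c * q x" for c x
    using q by (simp add: sublinear_def)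
  have "q (c *\<^sub>R x) = c * q x" for c x
  proof (cases "0 \<le> c")
    case True
    then show ?thesis by (rule hom)
  next
    case False
    then have "q ((- c) *\<^sub>R x) = - c * q x"
      by (intro hom) simp
    then show ?thesis using neg[of "c *\<^sub>R x"] by simp
  qed
  with add show ?thesis
    by (intro linearI) auto
qed

text \<open>
  A minimal sublinear functional below the regularization of \<open>p\<close> along \<open>z\<close> is linear, and its value
  at \<open>- z\<close> is at most \<open>- p z\<close>; so it touches \<open>p\<close> at \<open>z\<close>.
\<close>

lemma Hahn_Banach_support:
  fixes p :: "'v::real_vector \<Rightarrow> real"
  assumes p: "sublinear p"
  obtains l where "linear l" "\<And>x. l x \<le> p x" "l z = p z"
proof -
  obtain q where q: "sublinear q" "q \<le> regularize_along p z" "\<And>r. sublinear r \<Longrightarrow> r \<le> q \<Longrightarrow> r = q"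
    using sublinear_minimal_exists[OF sublinear_regularize_along[OF p]] by blast
  have lin: "linear q"
    by (rule sublinear_minimal_imp_linear[OF q(1,3)])
  have le: "q x \<le> p x" for x
    using q(2) regularize_along_le[OF p, of 0 z x] by (simp add: le_fun_def) (metis order_trans)
  have "q (- z) \<le> - p z"
    using q(2) regularize_along_le[OF p, of 1 z "- z"] sublinear_zero[OF p]
    by (simp add: le_fun_def) (metis order_trans)
  then have "p z \<le> q z"
    by (simp add: linear_neg[OF lin])
  with lin le show thesis by (intro that[of q] antisym) auto
qed

text \<open>
  Composing \<open>p\<close> with a linear projection onto the subspace yields a sublinear functional on the whole
  space.
\<close>

lemma Hahn_Banach_support_subspace:
  fixes p :: "'v::real_vector \<Rightarrow> real"
  assumes V: "subspace V"
    and add: "\<And>x y. x \<in> V \<Longrightarrow> y \<in> V \<Longrightarrow> p (x + y) \<le> p x + p y" and zero: "p 0 \<le> 0"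
    and scale: "\<And>c x. 0 < c \<Longrightarrow> x \<in> V \<Longrightarrow> p (c *\<^sub>R x) \<le> c * p x"
    and z: "z \<in> V"
  obtains l where "linear l" "\<And>x. x \<in> V \<Longrightarrow> l x \<le> p x" "l z = p z"
proof -
  obtain P :: "'v \<Rightarrow> 'v" where P: "range P \<subseteq> V" "linear P" "\<And>x. x \<in> V \<Longrightarrow> P x = x"
    using linear_exists_left_inverse_on[OF linear_id V inj_on_id] by auto
  have "sublinear (p \<circ> P)"
  proof (rule sublinearI)
    fix x y
    show "(p \<circ> P) (x + y) \<le> (p \<circ> P) x + (p \<circ> P) y"
      using P(1) add[of "P x" "P y"] by (auto simp: linear_add[OF P(2)])
  next
    show "(p \<circ> P) 0 \<le> 0" using zero by (simp add: linear_0[OF P(2)])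
  next
    fix c :: real and x assume "0 < c"
    then show "(p \<circ> P) (c *\<^sub>R x) \<le> c * (p \<circ> P) x"
      using P(1) scale[of c "P x"] by (auto simp: linear_cmul[OF P(2)])
  qed
  then obtain l where "linear l" "\<And>x. l x \<le> (p \<circ> P) x" "l z = (p \<circ> P) z"
    by (rule Hahn_Banach_support[of _ z]) blast
  then show thesis
    using P(3) z by (intro that[of l]) (auto simp: o_def, metis)
qed


section \<open>The Wasserstein norm as a seminorm\<close>

text \<open>
  The Wasserstein seminorm lives on a space of vector-valued set functions with pointwise operations.
\<close>

instantiation "fun" :: (type, real_vector) real_vector
begin

definition "scaleR_fun c f = (\<lambda>x. c *\<^sub>R f x)"

instance
  by standard (simp_all add: scaleR_fun_def fun_eq_iff algebra_simps)

end

lemma scaleR_fun_apply [simp]: "(c *\<^sub>R f) x = c *\<^sub>R f x"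
  by (simp add: scaleR_fun_def)

lemma sum_fun_apply [simp]: "(\<Sum>i\<in>I. f i) x = (\<Sum>i\<in>I. f i x)"
  by (induction I rule: infinite_finite_induct) auto

lemma transports_lincomb:
  assumes "\<pi> \<in> transports \<mu>" "\<rho> \<in> transports \<nu>"
  shows "a *\<^sub>R \<pi> + b *\<^sub>R \<rho> \<in> transports (a *\<^sub>R \<mu> + b *\<^sub>R \<nu>)"
proof -
  have "vector_measure (a *\<^sub>R \<pi> + b *\<^sub>R \<rho>)"
    using assms by (auto simp: transports_def vector_measure_def intro!: sums_add sums_scaleR_right)
  moreover have "a *\<^sub>R \<mu> A + b *\<^sub>R \<nu> A
      = a *\<^sub>R \<pi> (A \<times> UNIV) + b *\<^sub>R \<rho> (A \<times> UNIV) - (a *\<^sub>R \<pi> (UNIV \<times> A) + b *\<^sub>R \<rho> (UNIV \<times> A))"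
    if "A \<in> sets borel" for A
  proof -
    have eqs: "\<mu> A = \<pi> (A \<times> UNIV) - \<pi> (UNIV \<times> A)" "\<nu> A = \<rho> (A \<times> UNIV) - \<rho> (UNIV \<times> A)"
      using assms that by (auto simp: transports_def marginal1_def marginal2_def)
    show ?thesis unfolding eqs by (simp add: scaleR_diff_right)
  qed
  ultimately show ?thesis
    by (simp add: transports_def marginal1_def marginal2_def)
qed

text \<open>
  The cost only grows when the total variation is replaced by measures that dominate the norm.
\<close>

lemma transport_cost_least:
  fixes \<pi> :: "('a::{metric_space, second_countable_topology} \<times> 'a) set \<Rightarrow> 'b::real_normed_vector"
  assumes \<pi>: "vector_measure \<pi>" and sets: "\<And>i. i \<in> I \<Longrightarrow> sets (M i) = sets borel"
    and le: "\<And>B. B \<in> sets borel \<Longrightarrow> ennreal (norm (\<pi> B)) \<le> (\<Sum>i\<in>I. c i * emeasure (M i) B)"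
  shows "transport_cost \<pi> \<le> (\<Sum>i\<in>I. c i * (\<integral>\<^sup>+p. ennreal (dist (fst p) (snd p)) \<partial>M i))"
proof -
  have "(\<integral>\<^sup>+p. ennreal (dist (fst p) (snd p)) \<partial>total_variation \<pi>)
      \<le> (\<Sum>i\<in>I. c i * (\<integral>\<^sup>+p. ennreal (dist (fst p) (snd p)) \<partial>M i))"
  proof (rule nn_integral_le_lincomb)
    show "sets (M i) = sets (total_variation \<pi>)" if "i \<in> I" for i
      using sets[OF that] by simp
    show "emeasure (total_variation \<pi>) B \<le> (\<Sum>i\<in>I. c i * emeasure (M i) B)"
      if "B \<in> sets (total_variation \<pi>)" for B
      by (rule total_variation_least[OF \<pi> _ sets le]) (use that in auto)
    show "(\<lambda>p. ennreal (dist (fst p) (snd p))) \<in> borel_measurable (total_variation \<pi>)"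
      by measurable
  qed
  then show ?thesis
    by (simp add: transport_cost_on_eq)
qed

lemma transport_cost_lincomb:
  fixes \<pi> \<rho> :: "('a::{metric_space, second_countable_topology} \<times> 'a) set \<Rightarrow> 'b::real_normed_vector"
  assumes "vector_measure \<pi>" "vector_measure \<rho>"
  shows "transport_cost (a *\<^sub>R \<pi> + b *\<^sub>R \<rho>) \<le> ennreal \<bar>a\<bar> * transport_cost \<pi> + ennreal \<bar>b\<bar> * transport_cost \<rho>"
proof -
  have "vector_measure (a *\<^sub>R \<pi> + b *\<^sub>R \<rho>)"
    using assms by (auto simp: vector_measure_def intro!: sums_add sums_scaleR_right)
  then have "transport_cost (a *\<^sub>R \<pi> + b *\<^sub>R \<rho>)
      \<le> (\<Sum>i\<in>UNIV. ennreal (if i then \<bar>a\<bar> else \<bar>b\<bar>)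
          * (\<integral>\<^sup>+p. ennreal (dist (fst p) (snd p)) \<partial>total_variation (if i then \<pi> else \<rho>)))"
  proof (rule transport_cost_least)
    fix B :: "('a \<times> 'a) set" assume B: "B \<in> sets borel"
    have "ennreal (norm ((a *\<^sub>R \<pi> + b *\<^sub>R \<rho>) B)) \<le> ennreal (\<bar>a\<bar> * norm (\<pi> B) + \<bar>b\<bar> * norm (\<rho> B))"
      by (intro ennreal_leI) (use norm_triangle_ineq[of "a *\<^sub>R \<pi> B" "b *\<^sub>R \<rho> B"] in simp)
    also have "\<dots> = ennreal \<bar>a\<bar> * ennreal (norm (\<pi> B)) + ennreal \<bar>b\<bar> * ennreal (norm (\<rho> B))"
      by (simp add: ennreal_mult)
    also have "\<dots> \<le> ennreal \<bar>a\<bar> * emeasure (total_variation \<pi>) B + ennreal \<bar>b\<bar> * emeasure (total_variation \<rho>) B"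
      using assms B by (intro add_mono mult_left_mono norm_le_total_variation) auto
    finally show "ennreal (norm ((a *\<^sub>R \<pi> + b *\<^sub>R \<rho>) B))
        \<le> (\<Sum>i\<in>UNIV. ennreal (if i then \<bar>a\<bar> else \<bar>b\<bar>) * emeasure (total_variation (if i then \<pi> else \<rho>)) B)"
      by (simp add: UNIV_bool add.commute)
  qed simp
  then show ?thesis
    by (simp add: UNIV_bool transport_cost_on_eq add.commute)
qed

text \<open>
  The domain on which the Wasserstein norm is finite. Membership constrains only the values on Borel
  sets; the other values are arbitrary, which does not affect the norm.
\<close>

definition transportable :: "('a::metric_space set \<Rightarrow> 'b::real_normed_vector) set" where
  "transportable = {\<nu>. \<exists>\<pi>\<in>transports \<nu>. transport_cost \<pi> < \<infinity>}"

lemma transportableI: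
  "\<pi> \<in> transports \<nu> \<Longrightarrow> transport_cost \<pi> \<le> ennreal C \<Longrightarrow> \<nu> \<in> transportable"
  unfolding transportable_def using le_less_trans[OF _ ennreal_less_top, of "transport_cost \<pi>" C] by auto

lemma transportable_lincomb:
  fixes \<mu> \<nu> :: "'a::{metric_space, second_countable_topology} set \<Rightarrow> 'b::real_normed_vector"
  assumes "\<mu> \<in> transportable" "\<nu> \<in> transportable"
  shows "a *\<^sub>R \<mu> + b *\<^sub>R \<nu> \<in> transportable"
proof -
  obtain \<pi> \<rho> where *: "\<pi> \<in> transports \<mu>" "\<rho> \<in> transports \<nu>" "transport_cost \<pi> < \<infinity>" "transport_cost \<rho> < \<infinity>"
    using assms by (auto simp: transportable_def)
  then have "transport_cost (a *\<^sub>R \<pi> + b *\<^sub>R \<rho>) \<le> ennreal \<bar>a\<bar> * transport_cost \<pi> + ennreal \<bar>b\<bar> * transport_cost \<rho>"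
    by (intro transport_cost_lincomb) (auto simp: transports_def)
  also have "\<dots> < \<infinity>"
    using * by (simp add: ennreal_mult_less_top)
  finally show ?thesis
    using transports_lincomb[OF *(1,2)] by (auto simp: transportable_def)
qed

lemma subspace_transportable:
  "subspace (transportable :: ('a::{metric_space, second_countable_topology} set \<Rightarrow> 'b::real_normed_vector) set)"
proof (rule subspaceI)
  show "x + y \<in> transportable" if "x \<in> transportable" "y \<in> transportable" for x y :: "'a set \<Rightarrow> 'b"
    using transportable_lincomb[OF that, of 1 1] by simp
  show "c *\<^sub>R x \<in> transportable" if "x \<in> transportable" for c and x :: "'a set \<Rightarrow> 'b"
    using transportable_lincomb[OF that that, of c 0] by simp
  have "vector_measure (0 :: ('a \<times> 'a) set \<Rightarrow> 'b)"
    by (simp add: vector_measure_def)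
  moreover from this have "transport_cost (0 :: ('a \<times> 'a) set \<Rightarrow> 'b) \<le> 0"
    using transport_cost_lincomb[of 0 0 0 0] by simp
  ultimately have "(0 :: ('a \<times> 'a) set \<Rightarrow> 'b) \<in> transports 0" "transport_cost (0 :: ('a \<times> 'a) set \<Rightarrow> 'b) = 0"
    by (simp_all add: transports_def marginal1_def marginal2_def)
  then show "(0 :: 'a set \<Rightarrow> 'b) \<in> transportable"
    unfolding transportable_def by (metis (mono_tags, lifting) ennreal_zero_less_top infinity_ennreal_def mem_Collect_eq)
qed

text \<open>
  A set function without a transport of finite cost has infinite norm and gets the value 0 here, so
  this is a seminorm only on the transportable ones.
\<close>

definition real_wasserstein_norm :: "('a::metric_space set \<Rightarrow> real ^ 'm) \<Rightarrow> real" where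
  "real_wasserstein_norm \<nu> = enn2real (wasserstein_norm \<nu>)"

lemma wasserstein_norm_le: "\<pi> \<in> transports \<nu> \<Longrightarrow> wasserstein_norm \<nu> \<le> transport_cost \<pi>"
  unfolding wasserstein_norm_def by (rule INF_lower)

lemma wasserstein_norm_transportable:
  assumes "\<nu> \<in> transportable"
  shows "wasserstein_norm \<nu> = ennreal (real_wasserstein_norm \<nu>)"
proof -
  obtain \<pi> where \<pi>: "\<pi> \<in> transports \<nu>" "transport_cost \<pi> < \<infinity>"
    using assms by (auto simp: transportable_def)
  have "wasserstein_norm \<nu> < \<infinity>"
    using wasserstein_norm_le[OF \<pi>(1)] \<pi>(2) by (rule le_less_trans)
  then show ?thesis by (simp add: real_wasserstein_norm_def less_top)
qed

lemma real_wasserstein_norm_le: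
  "\<pi> \<in> transports \<nu> \<Longrightarrow> transport_cost \<pi> \<le> ennreal C \<Longrightarrow> 0 \<le> C \<Longrightarrow> real_wasserstein_norm \<nu> \<le> C"
  unfolding real_wasserstein_norm_def by (rule enn2real_leI) (auto intro: order_trans wasserstein_norm_le)

lemma near_optimal_transport:
  assumes "\<nu> \<in> transportable" "0 < e"
  obtains \<pi> where "\<pi> \<in> transports \<nu>" "transport_cost \<pi> \<le> ennreal (real_wasserstein_norm \<nu> + e)"
proof -
  have "wasserstein_norm \<nu> < ennreal (real_wasserstein_norm \<nu> + e)"
    unfolding wasserstein_norm_transportable[OF assms(1)]
    using assms(2) by (intro ennreal_lessI) (auto simp: real_wasserstein_norm_def add_nonneg_pos)
  then show thesis
    using that unfolding wasserstein_norm_def[of \<nu>] INF_less_iff by (meson less_imp_le)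
qed

text \<open>
  Near-optimal transports of \<open>\<mu>\<close> and \<open>\<nu>\<close> combine to a transport of the linear combination.
\<close>

lemma real_wasserstein_norm_lincomb:
  fixes \<mu> \<nu> :: "'a::{metric_space, second_countable_topology} set \<Rightarrow> real ^ 'm"
  assumes "\<mu> \<in> transportable" "\<nu> \<in> transportable"
  shows "real_wasserstein_norm (a *\<^sub>R \<mu> + b *\<^sub>R \<nu>) \<le> \<bar>a\<bar> * real_wasserstein_norm \<mu> + \<bar>b\<bar> * real_wasserstein_norm \<nu>"
proof (rule field_le_epsilon)
  fix e :: real assume e: "0 < e"
  \<comment> \<open>The summand 1 keeps the denominator positive when \<open>a = b = 0\<close>.\<close>
  define d where "d = e / (\<bar>a\<bar> + \<bar>b\<bar> + 1)"
  have d: "0 < d" using e by (simp add: d_def)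
  have W: "0 \<le> real_wasserstein_norm \<mu>" "0 \<le> real_wasserstein_norm \<nu>" by (simp_all add: real_wasserstein_norm_def)
  obtain \<pi> \<rho> where *: "\<pi> \<in> transports \<mu>" "transport_cost \<pi> \<le> ennreal (real_wasserstein_norm \<mu> + d)"
    "\<rho> \<in> transports \<nu>" "transport_cost \<rho> \<le> ennreal (real_wasserstein_norm \<nu> + d)"
    using assms d by (metis near_optimal_transport)
  have "transport_cost (a *\<^sub>R \<pi> + b *\<^sub>R \<rho>) \<le> ennreal \<bar>a\<bar> * transport_cost \<pi> + ennreal \<bar>b\<bar> * transport_cost \<rho>"
    using * by (intro transport_cost_lincomb) (auto simp: transports_def)
  also have "\<dots> \<le> ennreal \<bar>a\<bar> * ennreal (real_wasserstein_norm \<mu> + d) + ennreal \<bar>b\<bar> * ennreal (real_wasserstein_norm \<nu> + d)"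
    using * by (intro add_mono mult_left_mono) auto
  also have "\<dots> = ennreal (\<bar>a\<bar> * (real_wasserstein_norm \<mu> + d) + \<bar>b\<bar> * (real_wasserstein_norm \<nu> + d))"
    using W d by (simp add: ennreal_mult)
  finally have "real_wasserstein_norm (a *\<^sub>R \<mu> + b *\<^sub>R \<nu>) \<le> \<bar>a\<bar> * (real_wasserstein_norm \<mu> + d) + \<bar>b\<bar> * (real_wasserstein_norm \<nu> + d)"
    using transports_lincomb[OF *(1,3), of a b] W d by (intro real_wasserstein_norm_le) auto
  also have "\<dots> = \<bar>a\<bar> * real_wasserstein_norm \<mu> + \<bar>b\<bar> * real_wasserstein_norm \<nu> + (\<bar>a\<bar> + \<bar>b\<bar>) * d"
    by (simp add: algebra_simps)
  also have "(\<bar>a\<bar> + \<bar>b\<bar>) * d \<le> e"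
  proof -
    have "(\<bar>a\<bar> + \<bar>b\<bar>) * d \<le> (\<bar>a\<bar> + \<bar>b\<bar> + 1) * d"
      using d by (intro mult_right_mono) auto
    also have "\<dots> = e"
    proof -
      have "\<bar>a\<bar> + \<bar>b\<bar> + 1 \<noteq> 0"
        using abs_ge_zero[of a] abs_ge_zero[of b] by linarith
      then show ?thesis unfolding d_def by (metis nonzero_mult_div_cancel_left times_divide_eq_right)
    qed
    finally show ?thesis .
  qed
  finally show "real_wasserstein_norm (a *\<^sub>R \<mu> + b *\<^sub>R \<nu>) \<le> \<bar>a\<bar> * real_wasserstein_norm \<mu> + \<bar>b\<bar> * real_wasserstein_norm \<nu> + e"
    by simp
qed

text \<open>
  The transport is the push-forward of \<open>\<mu>\<close> under \<open>x \<mapsto> (x, T x)\<close>; its total variation is at most the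
  push-forward of the total variation of \<open>\<mu>\<close>.
\<close>

lemma transport_along_map:
  fixes \<mu> :: "'a::{metric_space, second_countable_topology} set \<Rightarrow> 'b::real_normed_vector"
  assumes \<mu>: "vector_measure \<mu>" and T[measurable]: "T \<in> borel_measurable borel"
  obtains \<pi> where "\<pi> \<in> transports (\<lambda>A. \<mu> A - \<mu> (T -` A))"
    "transport_cost \<pi> \<le> (\<integral>\<^sup>+x. ennreal (dist x (T x)) \<partial>total_variation \<mu>)"
proof -
  define F where "F x = (x, T x)" for x
  have F[measurable]: "F \<in> borel_measurable borel"
    unfolding F_def by (intro borel_measurable_Pair) measurable
  have F': "F -` A \<in> sets borel" if "A \<in> sets borel" for A
    using measurable_sets[OF F that] by simp
  define \<pi> where "\<pi> A = \<mu> (F -` A)" for A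
  have v: "vector_measure \<pi>"
    unfolding vector_measure_def
  proof (intro allI impI)
    fix A :: "nat \<Rightarrow> ('a \<times> 'a) set" assume A: "range A \<subseteq> sets borel" "disjoint_family A"
    have "disjoint_family (\<lambda>n. F -` A n)"
      using A(2) unfolding disjoint_family_on_def by blast
    then have "(\<lambda>n. \<mu> (F -` A n)) sums \<mu> (\<Union>n. F -` A n)"
      using A(1) F' by (intro vector_measure_sums[OF \<mu>]) auto
    then show "(\<lambda>n. \<pi> (A n)) sums \<pi> (\<Union>n. A n)"
      by (simp add: \<pi>_def vimage_UN)
  qed
  have "F -` (A \<times> UNIV) = A" "F -` (UNIV \<times> A) = T -` A" for A
    by (auto simp: F_def)
  then have "\<pi> \<in> transports (\<lambda>A. \<mu> A - \<mu> (T -` A))"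
    using v by (simp add: transports_def marginal1_def marginal2_def \<pi>_def)
  moreover have "transport_cost \<pi> \<le> (\<Sum>i\<in>{()}. 1 *
      (\<integral>\<^sup>+p. ennreal (dist (fst p) (snd p)) \<partial>distr (total_variation \<mu>) borel F))"
    using norm_le_total_variation[OF \<mu> F']
    by (intro transport_cost_least[OF v]) (auto simp: emeasure_distr \<pi>_def)
  then have "transport_cost \<pi> \<le> (\<integral>\<^sup>+x. ennreal (dist x (T x)) \<partial>total_variation \<mu>)"
    by (simp add: nn_integral_distr) (simp add: F_def)
  ultimately show thesis by (rule that)
qed

definition point_mass :: "'b \<Rightarrow> 'a \<Rightarrow> 'a set \<Rightarrow> 'b::real_vector" where
  "point_mass c x A = indicator A x *\<^sub>R c"

text \<open>
  Moving the vector mass \<open>c\<close> from \<open>x\<close> to \<open>y\<close> is the point mass at \<open>(x, y)\<close>. Its total variation is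
  dominated by \<open>\<parallel>c\<parallel>\<close> times the unit mass at \<open>(x, y)\<close>, which is the image of the counting measure
  on a one-point space.
\<close>

lemma transport_point_mass:
  fixes x y :: "'a::{metric_space, second_countable_topology}" and c :: "'b::real_normed_vector"
  obtains \<pi> where "\<pi> \<in> transports (point_mass c x - point_mass c y)"
    "transport_cost \<pi> \<le> ennreal (norm c * dist x y)"
proof -
  define \<pi> where "\<pi> = point_mass c (x, y)"
  have v: "vector_measure \<pi>"
    unfolding vector_measure_def \<pi>_def point_mass_def
    by (auto intro!: sums_scaleR_left indicator_sums simp: disjoint_family_on_def)
  have "\<pi> \<in> transports (point_mass c x - point_mass c y)"
    using v by (simp add: transports_def marginal1_def marginal2_def \<pi>_def point_mass_def indicator_def)
  moreover have "transport_cost \<pi> \<le> (\<Sum>i\<in>{()}. ennreal (norm c) *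
      (\<integral>\<^sup>+p. ennreal (dist (fst p) (snd p)) \<partial>distr (count_space {()}) borel (\<lambda>_. (x, y))))"
    by (intro transport_cost_least[OF v])
       (auto simp: emeasure_distr \<pi>_def point_mass_def indicator_def ennreal_mult)
  then have "transport_cost \<pi> \<le> ennreal (norm c * dist x y)"
    by (simp add: nn_integral_distr nn_integral_count_space_finite ennreal_mult)
  ultimately show thesis by (rule that)
qed


section \<open>Strong duality\<close>

lemma vector_measure_finite_UN:
  assumes \<mu>: "vector_measure \<mu>" and "finite Y"
    and "\<And>y. y \<in> Y \<Longrightarrow> B y \<in> sets borel" "disjoint_family_on B Y"
  shows "\<mu> (\<Union>y\<in>Y. B y) = (\<Sum>y\<in>Y. \<mu> (B y))"
  using assms(2-)
proof (induction Y rule: finite_induct)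
  case empty
  then show ?case by (simp add: vector_measure_empty[OF \<mu>])
next
  case (insert y Y)
  have "\<mu> (B y \<union> (\<Union>y\<in>Y. B y)) = \<mu> (B y) + \<mu> (\<Union>y\<in>Y. B y)"
    using insert.prems insert.hyps
    by (intro vector_measure_Un[OF \<mu>]) (auto simp: disjoint_family_on_def)
  moreover have "disjoint_family_on B Y"
    using insert.prems(2) by (auto simp: disjoint_family_on_def)
  ultimately show ?case
    using insert by simp
qed

text \<open>
  Collapsing the whole space to the base point transports \<open>\<mu>\<close> to \<open>\<mu>(X)\<close> times a point mass, which is
  zero, at a cost bounded by the first moment.
\<close>

lemma wasserstein_space_transportable:
  fixes \<mu> :: "'a::{metric_space, second_countable_topology} set \<Rightarrow> real ^ 'm"
  assumes \<mu>: "\<mu> \<in> wasserstein_space"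
  shows "\<mu> \<in> transportable"
proof -
  obtain x0 where v: "vector_measure \<mu>" and z: "\<mu> UNIV = 0"
    and fin: "(\<integral>\<^sup>+x. ennreal (dist x x0) \<partial>total_variation \<mu>) < \<infinity>"
    using \<mu> by (auto simp: wasserstein_space_def)
  obtain \<pi> where \<pi>: "\<pi> \<in> transports (\<lambda>A. \<mu> A - \<mu> ((\<lambda>_. x0) -` A))"
    "transport_cost \<pi> \<le> (\<integral>\<^sup>+x. ennreal (dist x x0) \<partial>total_variation \<mu>)"
    using transport_along_map[OF v, of "\<lambda>_. x0"] by auto
  have "(\<lambda>A. \<mu> A - \<mu> ((\<lambda>_. x0) -` A)) = \<mu>"
    using z vector_measure_empty[OF v] by (auto simp: vimage_const)
  with \<pi> fin show ?thesis
    by (auto simp: transportable_def intro: le_less_trans)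
qed

text \<open>
  The functional \<open>l\<close> comes from Hahn-Banach. The map \<open>c \<mapsto> l (point_mass c x - point_mass c y)\<close> is
  linear, so it is the scalar product with a vector \<open>v x - v y\<close>; testing with \<open>c = v x - v y\<close> and
  using the cost \<open>\<parallel>c\<parallel> d(x, y)\<close> of moving \<open>c\<close> shows \<open>\<parallel>v x - v y\<parallel> \<le> d(x, y)\<close>.
\<close>

lemma norming_functional_and_potential:
  fixes \<mu> :: "'a::{metric_space, second_countable_topology} set \<Rightarrow> real ^ 'm"
  assumes \<mu>: "\<mu> \<in> transportable"
  obtains l v where "linear l" "\<And>\<nu>. \<nu> \<in> transportable \<Longrightarrow> l \<nu> \<le> real_wasserstein_norm \<nu>" "l \<mu> = real_wasserstein_norm \<mu>"
    "1-lipschitz_on UNIV (v :: 'a \<Rightarrow> real ^ 'm)"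
    "\<And>c x y. l (point_mass c x - point_mass c y) = (v x - v y) \<bullet> c"
proof -
  have tr: "point_mass c x - point_mass c y \<in> transportable"
    and wn: "real_wasserstein_norm (point_mass c x - point_mass c y) \<le> norm c * dist x y" for x y :: 'a and c :: "real ^ 'm"
  proof -
    obtain \<pi> where *: "\<pi> \<in> transports (point_mass c x - point_mass c y)"
      "transport_cost \<pi> \<le> ennreal (norm c * dist x y)"
      by (rule transport_point_mass)
    then show "point_mass c x - point_mass c y \<in> transportable"
      by (rule transportableI)
    show "real_wasserstein_norm (point_mass c x - point_mass c y) \<le> norm c * dist x y"
      using * by (rule real_wasserstein_norm_le) simp
  qed
  have zero: "(0 :: 'a set \<Rightarrow> real ^ 'm) \<in> transportable"
    using subspace_0[OF subspace_transportable] .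
  obtain l :: "('a set \<Rightarrow> real ^ 'm) \<Rightarrow> real" where l: "linear l"
    "\<And>\<nu>. \<nu> \<in> transportable \<Longrightarrow> l \<nu> \<le> real_wasserstein_norm \<nu>" "l \<mu> = real_wasserstein_norm \<mu>"
  proof (rule Hahn_Banach_support_subspace[OF subspace_transportable, of real_wasserstein_norm \<mu>])
    show "real_wasserstein_norm (x + y) \<le> real_wasserstein_norm x + real_wasserstein_norm y"
      if "x \<in> transportable" "y \<in> transportable" for x y :: "'a set \<Rightarrow> real ^ 'm"
      using real_wasserstein_norm_lincomb[OF that, of 1 1] by simp
    show "real_wasserstein_norm (0 :: 'a set \<Rightarrow> real ^ 'm) \<le> 0"
      using real_wasserstein_norm_lincomb[OF zero zero, of 0 0] by simp
    show "real_wasserstein_norm (c *\<^sub>R x) \<le> c * real_wasserstein_norm x"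
      if "0 < c" "x \<in> transportable" for c and x :: "'a set \<Rightarrow> real ^ 'm"
      using real_wasserstein_norm_lincomb[OF that(2,2), of c 0] that(1) by simp
    show "\<mu> \<in> transportable" by (rule \<mu>)
  qed blast
  obtain x0 :: 'a where True by simp
  \<comment> \<open>Subtracting the mass at the base point makes the argument of \<open>l\<close> transportable, as its total
    mass must be zero.\<close>
  define v where "v x = (\<chi> i. l (point_mass (axis i 1) x - point_mass (axis i 1) x0))" for x
  have lin: "l (point_mass c x - point_mass c y) = (v x - v y) \<bullet> c" for c x y
  proof -
    have c: "c = (\<Sum>i\<in>UNIV. c $ i *\<^sub>R axis i 1)"
      using basis_expansion[of c] by (simp add: scalar_mult_eq_scaleR)
    have "point_mass c x - point_mass c y
        = (\<Sum>i\<in>UNIV. c $ i *\<^sub>R ((point_mass (axis i 1) x - point_mass (axis i 1) x0)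
            - (point_mass (axis i 1) y - point_mass (axis i 1) x0)))"
    proof
      fix A
      have "(point_mass c x - point_mass c y) A = (indicator A x - indicator A y) *\<^sub>R (\<Sum>i\<in>UNIV. c $ i *\<^sub>R axis i 1)"
        using c by (simp add: point_mass_def scaleR_diff_left)
      also have "\<dots> = (\<Sum>i\<in>UNIV. c $ i *\<^sub>R ((indicator A x - indicator A y) *\<^sub>R axis i 1))"
        by (simp add: scaleR_sum_right mult.commute)
      finally show "(point_mass c x - point_mass c y) A = (\<Sum>i\<in>UNIV. c $ i *\<^sub>R ((point_mass (axis i 1) x - point_mass (axis i 1) x0)
            - (point_mass (axis i 1) y - point_mass (axis i 1) x0))) A"
        by (simp add: point_mass_def scaleR_diff_left)
    qed
    then have "l (point_mass c x - point_mass c y) = (\<Sum>i\<in>UNIV. c $ i * (v x $ i - v y $ i))"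
      by (simp only: linear_sum[OF l(1)] linear_cmul[OF l(1)] linear_diff[OF l(1)] v_def vec_lambda_beta real_scaleR_def)
    then show ?thesis
      by (simp add: inner_vec_def mult.commute)
  qed
  have "1-lipschitz_on UNIV v"
  proof (rule lipschitz_onI)
    fix x y
    have "norm (v x - v y) * norm (v x - v y) = l (point_mass (v x - v y) x - point_mass (v x - v y) y)"
      by (simp only: lin dot_square_norm power2_eq_square)
    also have "\<dots> \<le> norm (v x - v y) * dist x y"
      using l(2)[OF tr] wn by (rule order_trans)
    finally show "dist (v x) (v y) \<le> 1 * dist x y"
      by (cases "v x = v y") (simp_all add: dist_norm)
  qed simp
  with l lin show thesis by (intro that)
qed

text \<open>
  The push-forward under a finitely valued \<open>T\<close> is a finite sum of point masses with coefficients
  \<open>\<mu> (T -` {y})\<close>. These add up to \<open>\<mu>(X) = 0\<close>, so each point mass may be compared with one at a fixed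
  base point.
\<close>

lemma potential_on_simple_pushforward:
  fixes \<mu> :: "'a::{metric_space, second_countable_topology} set \<Rightarrow> real ^ 'm" and T :: "'a \<Rightarrow> 'a"
  assumes \<mu>: "vector_measure \<mu>" "\<mu> UNIV = 0" and h: "polar_density \<mu> h"
    and l: "linear l" and lv: "\<And>c x y. l (point_mass c x - point_mass c y) = (v x - v y) \<bullet> c"
    and T: "finite (range T)" "\<And>y. T -` {y} \<in> sets borel"
  shows "l (\<lambda>A. \<mu> (T -` A)) = (\<integral>x. v (T x) \<bullet> h x \<partial>total_variation \<mu>)"
proof -
  let ?S = "total_variation \<mu>" and ?Y = "range T" and ?c = "\<lambda>y. \<mu> (T -` {y})"
  interpret S: finite_measure ?S by (rule finite_measure_total_variation[OF \<mu>(1)])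
  obtain x0 :: 'a where True by simp
  have push: "\<mu> (T -` A) = (\<Sum>y\<in>?Y. indicator A y *\<^sub>R ?c y)" for A
  proof -
    have "\<mu> (T -` A) = \<mu> (\<Union>y\<in>?Y \<inter> A. T -` {y})"
      by (rule arg_cong[of _ _ \<mu>]) auto
    also have "\<dots> = (\<Sum>y\<in>?Y \<inter> A. ?c y)"
      using T by (intro vector_measure_finite_UN[OF \<mu>(1)]) (auto simp: disjoint_family_on_def)
    also have "\<dots> = (\<Sum>y\<in>?Y. indicator A y *\<^sub>R ?c y)"
      unfolding sum.inter_restrict[OF T(1)] by (intro sum.cong) (auto simp: indicator_def)
    finally show ?thesis .
  qed
  have c0: "(\<Sum>y\<in>?Y. ?c y) = 0"
    using push[of UNIV] \<mu>(2) by simp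
  have "(\<lambda>A. \<mu> (T -` A)) = (\<Sum>y\<in>?Y. point_mass (?c y) y - point_mass (?c y) x0)"
  proof
    fix A
    have "(\<Sum>y\<in>?Y. point_mass (?c y) y - point_mass (?c y) x0) A
        = (\<Sum>y\<in>?Y. indicator A y *\<^sub>R ?c y) - indicator A x0 *\<^sub>R (\<Sum>y\<in>?Y. ?c y)"
      by (simp only: sum_fun_apply minus_apply point_mass_def sum_subtractf scaleR_sum_right)
    then show "\<mu> (T -` A) = (\<Sum>y\<in>?Y. point_mass (?c y) y - point_mass (?c y) x0) A"
      by (simp only: c0 push[of A] scaleR_zero_right diff_zero)
  qed
  then have "l (\<lambda>A. \<mu> (T -` A)) = (\<Sum>y\<in>?Y. (v y - v x0) \<bullet> ?c y)"
    by (simp only: linear_sum[OF l] lv)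
  also have "\<dots> = (\<Sum>y\<in>?Y. v y \<bullet> ?c y) - v x0 \<bullet> (\<Sum>y\<in>?Y. ?c y)"
    by (simp add: inner_diff_left sum_subtractf inner_sum_right)
  also have "\<dots> = (\<Sum>y\<in>?Y. v y \<bullet> ?c y)"
    by (simp only: c0 inner_zero_right diff_zero)
  also have "\<dots> = (\<Sum>y\<in>?Y. \<integral>x. v y \<bullet> (indicator (T -` {y}) x *\<^sub>R h x) \<partial>?S)"
  proof (intro sum.cong refl)
    fix y
    have "integrable ?S (\<lambda>x. indicator (T -` {y}) x *\<^sub>R h x)"
      using T(2)[of y] by (intro integrable_scaleR_polar[OF h]) (simp add: S.emeasure_eq_measure)
    then show "v y \<bullet> ?c y = (\<integral>x. v y \<bullet> (indicator (T -` {y}) x *\<^sub>R h x) \<partial>?S)"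
      by (simp only: integral_inner_right polar_densityD(3)[OF h T(2)])
  qed
  also have "\<dots> = (\<integral>x. (\<Sum>y\<in>?Y. v y \<bullet> (indicator (T -` {y}) x *\<^sub>R h x)) \<partial>?S)"
  proof (rule Bochner_Integration.integral_sum[symmetric])
    fix y
    show "integrable ?S (\<lambda>x. v y \<bullet> (indicator (T -` {y}) x *\<^sub>R h x))"
      using T(2)[of y] by (intro integrable_inner_right integrable_scaleR_polar[OF h]) (simp add: S.emeasure_eq_measure)
  qed
  also have "(\<lambda>x. \<Sum>y\<in>?Y. v y \<bullet> (indicator (T -` {y}) x *\<^sub>R h x)) = (\<lambda>x. v (T x) \<bullet> h x)"
  proof
    fix x
    have "(\<Sum>y\<in>?Y. v y \<bullet> (indicator (T -` {y}) x *\<^sub>R h x)) = (\<Sum>y\<in>?Y. if T x = y then v y \<bullet> h x else 0)"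
      by (intro sum.cong) (auto simp: indicator_def)
    also have "\<dots> = v (T x) \<bullet> h x"
      using T(1) by simp
    finally show "(\<Sum>y\<in>?Y. v y \<bullet> (indicator (T -` {y}) x *\<^sub>R h x)) = v (T x) \<bullet> h x" .
  qed
  finally show ?thesis .
qed

text \<open>
  For the potential \<open>v\<close> of the norming functional \<open>l\<close> and finitely valued maps \<open>F n\<close> tending to the
  identity, both \<open>l\<close> and integration of \<open>v\<close> change by at most \<open>\<integral>d(x, F n x) d\<parallel>\<mu>\<parallel>\<close> when \<open>\<mu>\<close> is
  replaced by its push-forward under \<open>F n\<close>, on which they agree. Hence they agree at \<open>\<mu>\<close> up to an
  error tending to zero.
\<close>

lemma strong_duality:
  fixes \<mu> :: "'a::{metric_space, second_countable_topology} set \<Rightarrow> real ^ 'm"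
  assumes \<mu>: "\<mu> \<in> wasserstein_space"
  obtains v :: "'a \<Rightarrow> real ^ 'm" where "1-lipschitz_on UNIV v" "enn2ereal (wasserstein_norm \<mu>) \<le> ereal (inner_integral \<mu> v)"
proof -
  let ?S = "total_variation \<mu>"
  obtain x0 where vm: "vector_measure \<mu>" and z: "\<mu> UNIV = 0"
    and fin: "(\<integral>\<^sup>+x. ennreal (dist x x0) \<partial>?S) < \<infinity>"
    using \<mu> by (auto simp: wasserstein_space_def)
  interpret S: finite_measure ?S by (rule finite_measure_total_variation[OF vm])
  note tr = wasserstein_space_transportable[OF \<mu>]
  obtain l v where l: "linear l" "\<And>\<nu>. \<nu> \<in> transportable \<Longrightarrow> l \<nu> \<le> real_wasserstein_norm \<nu>" "l \<mu> = real_wasserstein_norm \<mu>"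
    and v: "1-lipschitz_on UNIV (v :: 'a \<Rightarrow> real ^ 'm)"
    and lv: "\<And>c x y. l (point_mass c x - point_mass c y) = (v x - v y) \<bullet> c"
    using norming_functional_and_potential[OF tr] by blast
  obtain h where h: "polar_density \<mu> h" using polar_density_exists[OF vm] .
  have [measurable]: "v \<in> borel_measurable borel" by (rule measurable_lipschitz[OF v])
  have d0: "integrable ?S (\<lambda>x. dist x x0)"
    using fin by (simp add: integrable_iff_bounded)
  have iv: "integrable ?S v" by (rule integrable_lipschitz_wasserstein[OF \<mu> v])
  have inner_v: "inner_integral \<mu> v = (\<integral>x. v x \<bullet> h x \<partial>?S)"
    using polar_densityD(4)[OF h, of UNIV v] iv by (simp add: set_integrable_def set_lebesgue_integral_def)
  obtain F where F: "\<And>n. simple_function ?S (F n)" "\<And>x. (\<lambda>n. F n x) \<longlonglongrightarrow> x"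
      "\<And>n x. dist (F n x) x0 \<le> 2 * dist x x0"
  proof -
    have "(\<lambda>x. x) \<in> borel_measurable ?S" by simp
    from borel_measurable_implies_sequence_metric[OF this, of x0] that show thesis by auto
  qed
  have F_meas [measurable]: "F n \<in> borel_measurable borel" for n
    using borel_measurable_simple_function[OF F(1)[of n]] by simp
  \<comment> \<open>The factor 3 is 1 + 2: the triangle inequality through \<open>x0\<close> and the bound on \<open>F\<close>.\<close>
  have dF: "dist x (F n x) \<le> 3 * dist x x0" for n x
    using F(3)[of n x] dist_triangle2[of x "F n x" x0] by linarith
  have int_dF: "integrable ?S (\<lambda>x. dist x (F n x))" for n
  proof (rule Bochner_Integration.integrable_bound)
    show "integrable ?S (\<lambda>x. 3 * dist x x0)" using d0 by simp
    show "AE x in ?S. norm (dist x (F n x)) \<le> norm (3 * dist x x0)"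
      using dF by (intro AE_I2) simp
  qed measurable
  define \<delta> where "\<delta> n = (\<integral>x. dist x (F n x) \<partial>?S)" for n
  have "\<delta> \<longlonglongrightarrow> (\<integral>x. 0 \<partial>?S)"
    unfolding \<delta>_def
  proof (rule integral_dominated_convergence[where w = "\<lambda>x. 3 * dist x x0"])
    show "AE x in ?S. (\<lambda>n. dist x (F n x)) \<longlonglongrightarrow> 0"
    proof (intro AE_I2)
      fix x
      show "(\<lambda>n. dist x (F n x)) \<longlonglongrightarrow> 0"
        using tendsto_dist[OF tendsto_const F(2), of x x] by simp
    qed
  qed (use d0 dF in auto)
  then have \<delta>: "\<delta> \<longlonglongrightarrow> 0" by simp
  have bound: "real_wasserstein_norm \<mu> - 2 * \<delta> n \<le> inner_integral \<mu> v" for n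
  proof -
    let ?T = "F n" and ?\<nu> = "\<lambda>A. \<mu> (F n -` A)"
    have \<delta>0: "0 \<le> \<delta> n" unfolding \<delta>_def by (intro Bochner_Integration.integral_nonneg) simp
    obtain \<pi> where \<pi>: "\<pi> \<in> transports (\<lambda>A. \<mu> A - ?\<nu> A)"
      "transport_cost \<pi> \<le> (\<integral>\<^sup>+x. ennreal (dist x (?T x)) \<partial>?S)"
      by (rule transport_along_map[OF vm F_meas])
    have diff: "(\<lambda>A. \<mu> A - ?\<nu> A) = \<mu> - ?\<nu>" by (simp add: fun_eq_iff)
    have "(\<integral>\<^sup>+x. ennreal (dist x (?T x)) \<partial>?S) = ennreal (\<delta> n)"
      unfolding \<delta>_def by (rule nn_integral_eq_integral[OF int_dF]) simp
    with \<pi> have cost: "\<pi> \<in> transports (\<mu> - ?\<nu>)" "transport_cost \<pi> \<le> ennreal (\<delta> n)"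
      unfolding diff by simp_all
    have "\<mu> - ?\<nu> \<in> transportable"
      using cost by (rule transportableI)
    then have "l (\<mu> - ?\<nu>) \<le> \<delta> n"
      using real_wasserstein_norm_le[OF cost \<delta>0] l(2) by (meson order_trans)
    then have "real_wasserstein_norm \<mu> - \<delta> n \<le> l ?\<nu>"
      by (simp add: linear_diff[OF l(1)] l(3))
    also have "l ?\<nu> = (\<integral>x. v (?T x) \<bullet> h x \<partial>?S)"
    proof (rule potential_on_simple_pushforward[OF vm z h l(1) lv])
      show "finite (range ?T)"
        using F(1)[of n] by (simp add: simple_function_def)
      show "?T -` {y} \<in> sets borel" for y
        using measurable_sets[OF F_meas, of "{y}" n] by simp
    qed
    also have "\<dots> \<le> (\<integral>x. v x \<bullet> h x + dist x (?T x) \<partial>?S)"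
    proof (rule integral_mono)
      have "integrable ?S (\<lambda>x. v (?T x))"
      proof (rule Bochner_Integration.integrable_bound)
        show "integrable ?S (\<lambda>x. norm (v x) + dist x (?T x))"
          using iv int_dF by simp
        have "norm (v (?T x)) \<le> norm (v x) + dist x (?T x)" for x
          using lipschitz_1_norm_le[OF v, of "?T x" x] norm_triangle_sub[of "v (?T x)" "v x"]
          by (simp add: dist_commute)
        then show "AE x in ?S. norm (v (?T x)) \<le> norm (norm (v x) + dist x (?T x))"
          by (intro AE_I2) simp
      qed measurable
      then show "integrable ?S (\<lambda>x. v (?T x) \<bullet> h x)"
        by (rule integrable_inner_polar[OF h])
      show "integrable ?S (\<lambda>x. v x \<bullet> h x + dist x (?T x))"
        by (intro Bochner_Integration.integrable_add integrable_inner_polar[OF h iv] int_dF)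
      fix x
      have "(v (?T x) - v x) \<bullet> h x \<le> norm (v (?T x) - v x) * norm (h x)"
        by (rule norm_cauchy_schwarz)
      also have "\<dots> \<le> norm (v (?T x) - v x)"
        by (rule mult_left_le[OF polar_densityD(2)[OF h] norm_ge_zero])
      also have "\<dots> \<le> dist x (?T x)"
        using lipschitz_1_norm_le[OF v, of "?T x" x] by (simp add: dist_commute)
      finally show "v (?T x) \<bullet> h x \<le> v x \<bullet> h x + dist x (?T x)"
        by (simp add: inner_diff_left)
    qed
    also have "\<dots> = inner_integral \<mu> v + \<delta> n"
      unfolding inner_v \<delta>_def
      by (rule Bochner_Integration.integral_add[OF integrable_inner_polar[OF h iv] int_dF])
    finally show ?thesis by simp
  qed
  have "(\<lambda>n. real_wasserstein_norm \<mu> - 2 * \<delta> n) \<longlonglongrightarrow> real_wasserstein_norm \<mu> - 2 * 0"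
    by (intro tendsto_intros \<delta>)
  then have "real_wasserstein_norm \<mu> \<le> inner_integral \<mu> v"
    using bound by (intro LIMSEQ_le_const2) auto
  then have "enn2ereal (wasserstein_norm \<mu>) \<le> ereal (inner_integral \<mu> v)"
    unfolding wasserstein_norm_transportable[OF tr]
    by (simp add: real_wasserstein_norm_def enn2ereal_ennreal)
  with v show thesis by (rule that)
qed


section \<open>Characterization of optimality\<close>

lemma ereal_eq_enn2ereal_iff:
  "ereal r = enn2ereal c \<longleftrightarrow> c < \<infinity> \<and> r = enn2real c"
proof (cases c)
  case (real a)
  then show ?thesis by (simp add: enn2ereal_ennreal)
next
  case top
  then show ?thesis by simp
qed

(* The topology is Polish, but dist itself need not be complete, so the class polish_space
   (whose metric is complete) would be too strong. *)

theorem theorem3: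
  fixes \<mu> :: "'a::{metric_space, second_countable_topology} set \<Rightarrow> real ^ 'm"
    and u :: "'a \<Rightarrow> real ^ 'm" and \<pi> :: "('a \<times> 'a) set \<Rightarrow> real ^ 'm" and x0 :: 'a
  assumes "completely_metrizable_space (euclidean :: 'a topology)"
    and "\<mu> \<in> wasserstein_space"
    and "u \<in> lipschitz_space x0" and "1-lipschitz_on UNIV u"
    and "\<pi> \<in> transports \<mu>"
  shows
    "let i = (ereal (inner_integral \<mu> u) = enn2ereal (transport_cost \<pi>)
              \<and> transport_cost \<pi> = wasserstein_norm \<mu>);
         ii = (\<forall>A\<in>sets borel.
                ereal (inner_integral_on \<pi> A (\<lambda>(x, y). u x - u y)) = enn2ereal (transport_cost_on \<pi> A));
         iii = (ereal (inner_integral \<mu> u) = enn2ereal (transport_cost \<pi>));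
         iv = (optimal_potential \<mu> u \<and> optimal_transport \<mu> \<pi>)
     in (i \<longleftrightarrow> ii) \<and> (i \<longleftrightarrow> iii) \<and> (i \<longleftrightarrow> iv) \<and>
        (i \<longrightarrow> (AE (x, y) in total_variation \<pi>. norm (u x - u y) = dist x y))"
proof -
  note \<mu> = assms(2) and u = assms(4) and \<pi> = assms(5)
  have v\<pi>: "vector_measure \<pi>" using \<pi> by (simp add: transports_def)
  let ?du = "\<lambda>(x, y). u x - u y"
  define ii where "ii \<longleftrightarrow> (\<forall>A\<in>sets borel.
      ereal (inner_integral_on \<pi> A ?du) = enn2ereal (transport_cost_on \<pi> A))"
  define iii where "iii \<longleftrightarrow> ereal (inner_integral \<mu> u) = enn2ereal (transport_cost \<pi>)"
  define i where "i \<longleftrightarrow> iii \<and> transport_cost \<pi> = wasserstein_norm \<mu>"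
  define iv where "iv \<longleftrightarrow> optimal_potential \<mu> u \<and> optimal_transport \<mu> \<pi>"
  have weak: "ereal (inner_integral \<mu> v) \<le> enn2ereal (transport_cost \<rho>)"
    if "1-lipschitz_on UNIV v" "\<rho> \<in> transports \<mu>" for v \<rho>
    by (rule inner_integral_le_transport_cost[OF \<mu> that(2,1)])
  have tight: "transport_cost \<pi> < \<infinity>" "inner_integral_on \<pi> UNIV ?du = enn2real (transport_cost \<pi>)" if iii
    using that inner_integral_transport[OF \<mu> \<pi> _ u] by (auto simp: iii_def ereal_eq_enn2ereal_iff)
  have "i \<longleftrightarrow> iii"
  proof
    assume iii
    have "transport_cost \<pi> \<le> wasserstein_norm \<mu>"
      unfolding wasserstein_norm_def
    proof (rule INF_greatest)
      fix \<rho> assume "\<rho> \<in> transports \<mu>"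
      then have "enn2ereal (transport_cost \<pi>) \<le> enn2ereal (transport_cost \<rho>)"
        using weak[OF u] \<open>iii\<close> by (simp add: iii_def)
      then show "transport_cost \<pi> \<le> transport_cost \<rho>"
        by (simp add: less_eq_ennreal.rep_eq)
    qed
    then show i
      using \<open>iii\<close> wasserstein_norm_le[OF \<pi>] by (simp add: i_def iii_def)
  qed (simp add: i_def iii_def)
  moreover have "ii \<longleftrightarrow> iii"
  proof
    assume ii
    then have "transport_cost \<pi> < \<infinity>" "inner_integral_on \<pi> UNIV ?du = enn2real (transport_cost \<pi>)"
      unfolding ii_def ereal_eq_enn2ereal_iff by (simp_all add: ball_UNIV)
    then show iii
      using inner_integral_transport[OF \<mu> \<pi> _ u] by (simp add: iii_def ereal_eq_enn2ereal_iff)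
  next
    assume iii
    show ii
      unfolding ii_def ereal_eq_enn2ereal_iff
    proof (intro ballI conjI)
      fix A :: "('a \<times> 'a) set" assume A: "A \<in> sets borel"
      show "transport_cost_on \<pi> A < \<infinity>"
        using transport_cost_on_eq_integral[OF tight(1)[OF \<open>iii\<close>] A] by simp
      show "inner_integral_on \<pi> A ?du = enn2real (transport_cost_on \<pi> A)"
        by (rule tight_transport(2)[OF v\<pi> tight(1)[OF \<open>iii\<close>] u tight(2)[OF \<open>iii\<close>] A])
    qed
  qed
  moreover have "i \<longleftrightarrow> iv"
  proof
    assume i
    then have "ereal (inner_integral \<mu> v) \<le> ereal (inner_integral \<mu> u)" if "1-lipschitz_on UNIV v" for v
      using weak[OF that \<pi>] by (simp add: i_def iii_def)
    then have "ereal (inner_integral \<mu> u) = (SUP v\<in>{v. 1-lipschitz_on UNIV v}. ereal (inner_integral \<mu> v))"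
      using u by (intro antisym SUP_upper SUP_least) auto
    then show iv
      using \<open>i\<close> u \<pi> by (simp add: iv_def i_def optimal_potential_def optimal_transport_def)
  next
    assume iv
    then have W: "wasserstein_norm \<mu> = transport_cost \<pi>"
      and max: "ereal (inner_integral \<mu> u) = (SUP v\<in>{v. 1-lipschitz_on UNIV v}. ereal (inner_integral \<mu> v))"
      by (auto simp: iv_def optimal_potential_def optimal_transport_def)
    obtain v :: "'a \<Rightarrow> real ^ 'm" where v: "1-lipschitz_on UNIV v"
      "enn2ereal (wasserstein_norm \<mu>) \<le> ereal (inner_integral \<mu> v)"
      using strong_duality[OF \<mu>] .
    have "ereal (inner_integral \<mu> v) \<le> ereal (inner_integral \<mu> u)"
      unfolding max using v(1) by (intro SUP_upper) simp
    then have "enn2ereal (transport_cost \<pi>) \<le> ereal (inner_integral \<mu> u)"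
      using order_trans[OF v(2)] W by simp
    then show i
      using weak[OF u \<pi>] W by (simp add: i_def iii_def)
  qed
  moreover have "AE (x, y) in total_variation \<pi>. norm (u x - u y) = dist x y" if iii
    using tight_transport(1)[OF v\<pi> tight(1)[OF that] u tight(2)[OF that]]
    by (simp add: case_prod_beta')
  ultimately show ?thesis
    unfolding Let_def i_def[symmetric] ii_def[symmetric] iii_def[symmetric] iv_def[symmetric]
    by blast
qed

end
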